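(* Let $m\ge 2$, let $f\in\mathbb{R}^{d_1\times\cdots\times d_m}$ be a nonnegative weakly irreducible tensor and $1<p_1,\dots,p_m<\infty$ such that there exists $i\in[m]$ with $m-1\le (p_i-1)\big(\min_{k\in[m]\setminus\{i\}}p_k-(m-1)\big)$. Let $(\lambda_-^k)_{k\in\mathbb N}$, $(\lambda_+^k)_{k\in\mathbb N}$ and $(\mathbf x^k)_{k\in\mathbb N}$ be the sequences produced by the Higher-order Generalized Power Method (HGPM). Let $\tilde{\mathbf x}^*\in\mathcal S^d_{++}$ be a singular vector of $f$ with $Q(\tilde{\mathbf x}^* )=\|f\|_{p_1,\ldots,p_m}$ and let $\mathbf x^*:=(\tilde{\mathbf x}^*_1,\dots,\tilde{\mathbf x}^*_{i-1},\tilde{\mathbf x}^*_{i+1},\dots,\tilde{\mathbf x}^*_m)$, where $i$ is the index chosen in the initialization of HGPM. Then for all $k\in\mathbb N$, $$\lambda_-^k\le\lambda_-^{k+1}\le\|f\|_{p_1,\ldots,p_m}\le\lambda_+^{k+1}\le\lambda_+^k,\qquad \lim_{k\to\infty}\lambda_-^k=\|f\|_{p_1,\ldots,p_m}=\lim_{k\to\infty}\lambda_+^k,\qquad \lim_{k\to\infty}\mathbf x^k=\mathbf x^*,$$ and there exist $0<\nu<1$, $k_0\in\mathbb N$ and a norm $\|\cdot\|_G$ such that $\|\mathbf x^{k+1}-\mathbf x^*\|_G\le\nu\|\mathbf x^k-\mathbf x^*\|_G$ for all $k\ge k_0$.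
   Context: $[n]=\{1,\dots,n\}$; $f$ is identified with the multilinear form $f(\mathbf x_1,\ldots,\mathbf x_m)=\sum_{j_1,\ldots,j_m}f_{j_1,\ldots,j_m}x_{1,j_1}\cdots x_{m,j_m}$ on $\mathcal R^d=\mathbb{R}^{d_1}\times\cdots\times\mathbb{R}^{d_m}$. Inequalities entrywise. $p'=p/(p-1)$; $\psi_q(\mathbf y)_j=|y_j|^{q-1}\mathrm{sign}(y_j)$. $Q(\mathbf x)=|f(\mathbf x)|/\prod_k\|\mathbf x_k\|_{p_k}$, $\|f\|_{p_1,\ldots,p_m}=\max Q$. $\mathcal S^d_{++}=\{\mathbf x>0:\|\mathbf x_k\|_{p_k}=1\ \forall k\}$; singular vectors of $f$ are critical points of $Q$ (with $f(\mathbf x)\ne0$). $\nabla_kf(\mathbf x)$ is the vector of partial derivatives $\partial f/\partial x_{k,j_k}$; it does not depend on $\mathbf x_k$, so $\nabla_if(\mathbf x)$ makes sense for $\mathbf x\in\mathcal R^{d-d_i}:=\prod_{k\ne i}\mathbb{R}^{d_k}$. $\mathcal S^{d-d_i}_{++}=\{\mathbf x\in\mathcal R^{d-d_i}:\mathbf x>0,\|\mathbf x_k\|_{p_k}=1\ \forall k\neq i\}$. For $k\ne i$ and $\mathbf x\in\mathcal R^{d-d_i}$: $s_{i,k}(\mathbf x)=\psi_{p_k'}\big(\nabla_kf(\mathbf x_1,\ldots,\mathbf x_{i-1},\psi_{p_i'}(\nabla_if(\mathbf x)),\mathbf x_{i+1},\ldots,\mathbf x_m)\big)\in\mathbb{R}^{d_k}$.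 Weak irreducibility: the undirected graph on $V=\bigcup_k\{k\}\times[d_k]$, with $(k,j_k)\sim(l,j_l)$ ($k\ne l$) iff some $f_{j_1,\ldots,j_m}>0$ with these two indices fixed, is connected. HGPM: input $f$, $p_1,\dots,p_m$, $\epsilon>0$. Initialization: choose $i\in[m]$ with $(m-1)p_i'\le p_k$ for all $k\ne i$ (if $m=2$, choose $i$ with $p_i\le p_k$ for $k\ne i$); choose $\mathbf x^0\in\mathcal S^{d-d_i}_{++}$. For $k=0,1,2,\dots$: $\mathbf z^k=(s_{i,l}(\mathbf x^k))_{l\ne i}$; $\lambda_-^{k+1}=\prod_{l\ne i}\min_{j_l}(z^k_{l,j_l}/x^k_{l,j_l})^{(p_l-1)/(p_i'(m-1))}$, $\lambda_+^{k+1}=\prod_{l\ne i}\max_{j_l}(z^k_{l,j_l}/x^k_{l,j_l})^{(p_l-1)/(p_i'(m-1))}$; $\mathbf x^{k+1}=(\mathbf z^k_l/\|\mathbf z^k_l\|_{p_l})_{l\ne i}$; stop when $\lambda_+^k-\lambda_-^k<\epsilon$ (for the asymptotic statements the iteration is continued indefinitely). Here $\mathbb N=\{1,2,\dots\}$ for the index of the $\lambda$-sequences. *)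

theory Defs
  imports "HOL-Analysis.Analysis"
begin

text \<open>Conventions: modes are indexed by k < m (0-based), coordinates of mode k by j < d k.
 A tensor is a function on multi-indices J (functions nat => nat); only J in tidx m d matter.
 A point of R^d = R^{d_1} x ... x R^{d_m} is x :: nat => nat => real, x k j = x_{k,j}.\<close>

definition tidx :: "nat \<Rightarrow> (nat \<Rightarrow> nat) \<Rightarrow> (nat \<Rightarrow> nat) set" where
  "tidx m d = Pi\<^sub>E {..<m} (\<lambda>k. {..<d k})"

definition mlf :: "nat \<Rightarrow> (nat \<Rightarrow> nat) \<Rightarrow> ((nat \<Rightarrow> nat) \<Rightarrow> real) \<Rightarrow> (nat \<Rightarrow> nat \<Rightarrow> real) \<Rightarrow> real" where
  "mlf m d f x = (\<Sum>J\<in>tidx m d. f J * (\<Prod>k<m. x k (J k)))"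

definition grad :: "nat \<Rightarrow> (nat \<Rightarrow> nat) \<Rightarrow> ((nat \<Rightarrow> nat) \<Rightarrow> real) \<Rightarrow> nat \<Rightarrow> (nat \<Rightarrow> nat \<Rightarrow> real) \<Rightarrow> nat \<Rightarrow> real" where
  "grad m d f k x = (\<lambda>j. \<Sum>J\<in>{J\<in>tidx m d. J k = j}. f J * (\<Prod>l\<in>{..<m} - {k}. x l (J l)))"

definition pnorm :: "real \<Rightarrow> nat \<Rightarrow> (nat \<Rightarrow> real) \<Rightarrow> real" where
  "pnorm p n v = (\<Sum>j<n. \<bar>v j\<bar> powr p) powr (1 / p)"

definition conj_exp :: "real \<Rightarrow> real" where
  "conj_exp p = p / (p - 1)"

definition psi :: "real \<Rightarrow> (nat \<Rightarrow> real) \<Rightarrow> nat \<Rightarrow> real" where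
  "psi q v = (\<lambda>j. \<bar>v j\<bar> powr (q - 1) * sgn (v j))"

definition Qf :: "nat \<Rightarrow> (nat \<Rightarrow> nat) \<Rightarrow> ((nat \<Rightarrow> nat) \<Rightarrow> real) \<Rightarrow> (nat \<Rightarrow> real) \<Rightarrow> (nat \<Rightarrow> nat \<Rightarrow> real) \<Rightarrow> real" where
  "Qf m d f p x = \<bar>mlf m d f x\<bar> / (\<Prod>k<m. pnorm (p k) (d k) (x k))"

definition nonzero_pts :: "nat \<Rightarrow> (nat \<Rightarrow> nat) \<Rightarrow> (nat \<Rightarrow> nat \<Rightarrow> real) set" where
  "nonzero_pts m d = {x. \<forall>k<m. \<exists>j<d k. x k j \<noteq> 0}"

text \<open>||f||_{p_1,...,p_m} = max Q (written as the supremum, which is attained)\<close>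
definition tnorm :: "nat \<Rightarrow> (nat \<Rightarrow> nat) \<Rightarrow> ((nat \<Rightarrow> nat) \<Rightarrow> real) \<Rightarrow> (nat \<Rightarrow> real) \<Rightarrow> real" where
  "tnorm m d f p = (SUP x\<in>nonzero_pts m d. Qf m d f p x)"

definition nonneg_tensor :: "nat \<Rightarrow> (nat \<Rightarrow> nat) \<Rightarrow> ((nat \<Rightarrow> nat) \<Rightarrow> real) \<Rightarrow> bool" where
  "nonneg_tensor m d f \<longleftrightarrow> (\<forall>J\<in>tidx m d. 0 \<le> f J)"

definition wi_adj :: "nat \<Rightarrow> (nat \<Rightarrow> nat) \<Rightarrow> ((nat \<Rightarrow> nat) \<Rightarrow> real) \<Rightarrow> nat \<times> nat \<Rightarrow> nat \<times> nat \<Rightarrow> bool" where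
  "wi_adj m d f u v \<longleftrightarrow> fst u < m \<and> snd u < d (fst u) \<and> fst v < m \<and> snd v < d (fst v)
      \<and> fst u \<noteq> fst v \<and> (\<exists>J\<in>tidx m d. 0 < f J \<and> J (fst u) = snd u \<and> J (fst v) = snd v)"

definition weakly_irreducible :: "nat \<Rightarrow> (nat \<Rightarrow> nat) \<Rightarrow> ((nat \<Rightarrow> nat) \<Rightarrow> real) \<Rightarrow> bool" where
  "weakly_irreducible m d f \<longleftrightarrow>
     (\<forall>u v. fst u < m \<and> snd u < d (fst u) \<and> fst v < m \<and> snd v < d (fst v)
        \<longrightarrow> (wi_adj m d f)\<^sup>*\<^sup>* u v)"

definition S_pp :: "nat \<Rightarrow> (nat \<Rightarrow> nat) \<Rightarrow> (nat \<Rightarrow> real) \<Rightarrow> (nat \<Rightarrow> nat \<Rightarrow> real) set" where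
  "S_pp m d p = {x. \<forall>k<m. (\<forall>j<d k. 0 < x k j) \<and> pnorm (p k) (d k) (x k) = 1}"

definition S_pp_minus :: "nat \<Rightarrow> (nat \<Rightarrow> nat) \<Rightarrow> (nat \<Rightarrow> real) \<Rightarrow> nat \<Rightarrow> (nat \<Rightarrow> nat \<Rightarrow> real) set" where
  "S_pp_minus m d p i = {x. \<forall>k<m. k \<noteq> i \<longrightarrow> (\<forall>j<d k. 0 < x k j) \<and> pnorm (p k) (d k) (x k) = 1}"

definition singular_vector :: "nat \<Rightarrow> (nat \<Rightarrow> nat) \<Rightarrow> ((nat \<Rightarrow> nat) \<Rightarrow> real) \<Rightarrow> (nat \<Rightarrow> real) \<Rightarrow> (nat \<Rightarrow> nat \<Rightarrow> real) \<Rightarrow> bool" where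
  "singular_vector m d f p x \<longleftrightarrow> x \<in> nonzero_pts m d \<and> mlf m d f x \<noteq> 0 \<and>
     (\<forall>k<m. \<forall>j<d k. ((\<lambda>t. Qf m d f p (x(k := (x k)(j := t)))) has_real_derivative 0) (at (x k j)))"

definition s_map :: "nat \<Rightarrow> (nat \<Rightarrow> nat) \<Rightarrow> ((nat \<Rightarrow> nat) \<Rightarrow> real) \<Rightarrow> (nat \<Rightarrow> real) \<Rightarrow> nat \<Rightarrow> nat \<Rightarrow> (nat \<Rightarrow> nat \<Rightarrow> real) \<Rightarrow> nat \<Rightarrow> real" where
  "s_map m d f p i k x = psi (conj_exp (p k))
      (grad m d f k (x(i := psi (conj_exp (p i)) (grad m d f i x))))"

definition restr :: "nat \<Rightarrow> (nat \<Rightarrow> nat) \<Rightarrow> nat \<Rightarrow> (nat \<Rightarrow> nat \<Rightarrow> real) \<Rightarrow> nat \<Rightarrow> nat \<Rightarrow> real" where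
  "restr m d i y = (\<lambda>l j. if l < m \<and> l \<noteq> i \<and> j < d l then y l j else 0)"

definition hgpm_step :: "nat \<Rightarrow> (nat \<Rightarrow> nat) \<Rightarrow> ((nat \<Rightarrow> nat) \<Rightarrow> real) \<Rightarrow> (nat \<Rightarrow> real) \<Rightarrow> nat \<Rightarrow> (nat \<Rightarrow> nat \<Rightarrow> real) \<Rightarrow> nat \<Rightarrow> nat \<Rightarrow> real" where
  "hgpm_step m d f p i x = restr m d i
      (\<lambda>l j. s_map m d f p i l x j / pnorm (p l) (d l) (s_map m d f p i l x))"

definition hgpm_x :: "nat \<Rightarrow> (nat \<Rightarrow> nat) \<Rightarrow> ((nat \<Rightarrow> nat) \<Rightarrow> real) \<Rightarrow> (nat \<Rightarrow> real) \<Rightarrow> nat \<Rightarrow> (nat \<Rightarrow> nat \<Rightarrow> real) \<Rightarrow> nat \<Rightarrow> nat \<Rightarrow> nat \<Rightarrow> real" where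
  "hgpm_x m d f p i x0 k = (hgpm_step m d f p i ^^ k) x0"

text \<open>lambda_-^{k} and lambda_+^{k} for k \<ge> 1 (computed from x^{k-1}, z^{k-1})\<close>
definition hgpm_lam_minus :: "nat \<Rightarrow> (nat \<Rightarrow> nat) \<Rightarrow> ((nat \<Rightarrow> nat) \<Rightarrow> real) \<Rightarrow> (nat \<Rightarrow> real) \<Rightarrow> nat \<Rightarrow> (nat \<Rightarrow> nat \<Rightarrow> real) \<Rightarrow> nat \<Rightarrow> real" where
  "hgpm_lam_minus m d f p i x0 k =
     (let x = hgpm_x m d f p i x0 (k - 1) in
      \<Prod>l\<in>{..<m} - {i}. Min ((\<lambda>j. (s_map m d f p i l x j / x l j)
          powr ((p l - 1) / (conj_exp (p i) * real (m - 1)))) ` {..<d l}))"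

definition hgpm_lam_plus :: "nat \<Rightarrow> (nat \<Rightarrow> nat) \<Rightarrow> ((nat \<Rightarrow> nat) \<Rightarrow> real) \<Rightarrow> (nat \<Rightarrow> real) \<Rightarrow> nat \<Rightarrow> (nat \<Rightarrow> nat \<Rightarrow> real) \<Rightarrow> nat \<Rightarrow> real" where
  "hgpm_lam_plus m d f p i x0 k =
     (let x = hgpm_x m d f p i x0 (k - 1) in
      \<Prod>l\<in>{..<m} - {i}. Max ((\<lambda>j. (s_map m d f p i l x j / x l j)
          powr ((p l - 1) / (conj_exp (p i) * real (m - 1)))) ` {..<d l}))"

text \<open>G is a norm on the space R^{d-d_i} (represented by the functions fixed by restr)\<close>
definition norm_on_minus :: "nat \<Rightarrow> (nat \<Rightarrow> nat) \<Rightarrow> nat \<Rightarrow> ((nat \<Rightarrow> nat \<Rightarrow> real) \<Rightarrow> real) \<Rightarrow> bool" where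
  "norm_on_minus m d i G \<longleftrightarrow>
     (let V = {y. restr m d i y = y} in
       (\<forall>y\<in>V. 0 \<le> G y \<and> (G y = 0 \<longleftrightarrow> y = (\<lambda>l j. 0))) \<and>
       (\<forall>y\<in>V. \<forall>c. G (\<lambda>l j. c * y l j) = \<bar>c\<bar> * G y) \<and>
       (\<forall>y\<in>V. \<forall>z\<in>V. G (\<lambda>l j. y l j + z l j) \<le> G y + G z))"

definition hgpm_index_ok :: "nat \<Rightarrow> (nat \<Rightarrow> real) \<Rightarrow> nat \<Rightarrow> bool" where
  "hgpm_index_ok m p i \<longleftrightarrow> i < m \<and>
     (if m = 2 then (\<forall>k<m. k \<noteq> i \<longrightarrow> p i \<le> p k)
      else (\<forall>k<m. k \<noteq> i \<longrightarrow> real (m - 1) * conj_exp (p i) \<le> p k))"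

end

theory Submission
  imports Defs "HOL-Library.Landau_Symbols"
begin

text \<open>
  Write \<open>q = p\<^sub>i'\<close>, \<open>b\<^sub>l = p\<^sub>l - 1\<close> and \<open>\<kappa> = (m - 1) q - 1\<close>; the hypothesis on the exponents says
  \<open>\<kappa> \<le> b\<^sub>l\<close> for all \<open>l \<noteq> i\<close>. The map \<open>S = (s\<^sub>i\<^sub>l)\<^sub>l\<close> is order preserving and homogeneous in each block,
  so with \<open>mx l x y = max\<^sub>j x\<^sub>l\<^sub>j / y\<^sub>l\<^sub>j\<close> and \<open>D x y = \<Sum>\<^sub>l b\<^sub>l ln (mx l x y)\<close> one gets
  \<open>D (S x) (S y) \<le> \<kappa> \<Sum>\<^sub>l ln (mx l x y) \<le> D x y\<close> for normalised \<open>x\<close>, \<open>y\<close>. Applied to consecutive iterates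
  this gives the monotonicity of the bounds; applied to an iterate and the singular vector it shows that
  the weighted Hilbert distance \<open>V x = D x x\<^sup>* + D x\<^sup>* x\<close> does not increase. On an orbit in the limit set \<open>V\<close> is
  constant, and the equality case of the comparison together with weak irreducibility forces \<open>V = 0\<close>.

  For the rate, the singular vector turns \<open>f\<close> into a probability distribution on multi-indices for which
  the derivative of the iteration in the relative error \<open>x / x\<^sup>* - 1\<close> is a combination of conditional
  expectations. By Jensen's inequality it does not increase the Euclidean norm with weights
  \<open>b\<^sub>l\<close> times the \<open>p\<^sub>l\<close>-th power of \<open>x\<^sup>*\<^sub>l\<^sub>j\<close>, and equality is again excluded by weak irreducibility; compactness
  then gives a contraction factor below 1.
\<close>

section \<open>Preliminaries\<close>

text \<open>Bolzano-Weierstrass for points encoded as functions of which only finitely many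
  coordinates matter: each new coordinate costs one further subsequence. Both compactness arguments
  below rest on it.\<close>

lemma finite_coordinates_subseq:
  fixes X :: "nat \<Rightarrow> 'a \<Rightarrow> real"
  assumes "finite A" and "\<And>n a. a \<in> A \<Longrightarrow> \<bar>X n a\<bar> \<le> C a"
  shows "\<exists>r L. strict_mono (r :: nat \<Rightarrow> nat) \<and> (\<forall>a\<in>A. (\<lambda>n. X (r n) a) \<longlonglongrightarrow> L a)"
  using assms
proof (induction A rule: finite_induct)
  case empty
  show ?case by (auto intro!: exI[of _ id] simp: strict_mono_def)
next
  case (insert a A)
  then obtain r L where r: "strict_mono (r :: nat \<Rightarrow> nat)"
    and L: "\<forall>b\<in>A. (\<lambda>n. X (r n) b) \<longlonglongrightarrow> L b" by auto
  have "bounded (range (\<lambda>n. X (r n) a))"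
    using insert.prems by (auto simp: bounded_iff intro!: exI[of _ "C a"])
  from bounded_imp_convergent_subsequence[OF this] obtain l s where
    s: "strict_mono (s :: nat \<Rightarrow> nat)" and l: "((\<lambda>n. X (r n) a) \<circ> s) \<longlonglongrightarrow> l" by blast
  have "(\<lambda>n. X ((r \<circ> s) n) b) \<longlonglongrightarrow> (L(a := l)) b" if "b \<in> insert a A" for b
  proof (cases "b = a")
    case True
    then show ?thesis using l by (simp add: o_def)
  next
    case False
    then have "(\<lambda>n. X (r n) b) \<longlonglongrightarrow> L b" using L that by auto
    from LIMSEQ_subseq_LIMSEQ[OF this s] False show ?thesis by (simp add: o_def)
  qed
  moreover have "strict_mono (r \<circ> s)" using r s by (rule strict_mono_o)
  ultimately show ?case by blast
qed

lemma tendsto_Max_image: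
  fixes g :: "'a \<Rightarrow> 'b \<Rightarrow> real"
  assumes "finite A" "A \<noteq> {}" and "\<And>a. a \<in> A \<Longrightarrow> ((\<lambda>n. g a n) \<longlongrightarrow> L a) F"
  shows "((\<lambda>n. Max ((\<lambda>a. g a n) ` A)) \<longlongrightarrow> Max (L ` A)) F"
  using assms
proof (induction A rule: finite_ne_induct)
  case (singleton x)
  then show ?case by simp
next
  case (insert x A)
  then show ?case by (auto intro!: tendsto_max)
qed

text \<open>One strictly smaller factor makes the whole product strictly smaller, because the
  remaining factors have a positive product.\<close>

lemma prod_eq_imp_eq:
  fixes x y :: "'a \<Rightarrow> real"
  assumes "finite A" "\<And>a. a \<in> A \<Longrightarrow> 0 < x a \<and> x a \<le> y a" "prod x A = prod y A" "a \<in> A"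
  shows "x a = y a"
proof (rule ccontr)
  assume "x a \<noteq> y a"
  then have lt: "x a < y a" using assms(2)[OF assms(4)] by simp
  have P: "0 < prod x (A - {a})" by (intro prod_pos) (use assms in auto)
  have le: "prod x (A - {a}) \<le> prod y (A - {a})"
    by (intro prod_mono) (use assms in \<open>auto intro: less_imp_le\<close>)
  have "prod x A = x a * prod x (A - {a})" "prod y A = y a * prod y (A - {a})"
    using assms by (auto simp: prod.remove)
  moreover have "x a * prod x (A - {a}) < y a * prod x (A - {a})" using lt P by simp
  moreover have "y a * prod x (A - {a}) \<le> y a * prod y (A - {a})"
    using le lt assms(2)[OF assms(4)] by (intro mult_left_mono) auto
  ultimately show False using assms(3) by linarith
qed

lemma sum_eq_imp_eq:
  fixes x y :: "'a \<Rightarrow> real"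
  assumes "finite A" "\<And>a. a \<in> A \<Longrightarrow> x a \<le> y a" "sum x A = sum y A" "a \<in> A"
  shows "x a = y a"
proof -
  have "sum (\<lambda>a. y a - x a) A = 0" using assms(3) by (simp add: sum_subtractf)
  then have "y a - x a = 0"
    using sum_nonneg_eq_0_iff[of A "\<lambda>a. y a - x a"] assms(1,2,4) by auto
  then show ?thesis by simp
qed

section \<open>Norms and gradients of nonnegative forms\<close>

lemma pnorm_cong:
  "(\<And>j. j < n \<Longrightarrow> v j = w j) \<Longrightarrow> pnorm p n v = pnorm p n w"
  unfolding pnorm_def by (intro arg_cong2[where f="(powr)"] sum.cong refl) auto

lemma pnorm_pos:
  assumes "0 < n" "\<And>j. j < n \<Longrightarrow> 0 < v j"
  shows "0 < pnorm p n v"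
proof -
  have "0 < (\<Sum>j<n. \<bar>v j\<bar> powr p)"
    by (rule sum_pos) (use assms in fastforce)+
  then show ?thesis by (simp add: pnorm_def)
qed

lemma pnorm_divide:
  assumes "0 < c" "p \<noteq> 0"
  shows "pnorm p n (\<lambda>j. v j / c) = pnorm p n v / c"
proof -
  have "(\<Sum>j<n. \<bar>v j / c\<bar> powr p) = (\<Sum>j<n. \<bar>v j\<bar> powr p) / c powr p"
    using assms by (simp add: sum_divide_distrib powr_divide)
  then show ?thesis
    using assms by (simp add: pnorm_def powr_divide sum_nonneg powr_powr)
qed

lemma pnorm_strict_mono:
  assumes "0 < n" "0 < p" "\<And>j. j < n \<Longrightarrow> 0 < v j \<and> v j < w j"
  shows "pnorm p n v < pnorm p n w"
proof -
  have "(\<Sum>j<n. \<bar>v j\<bar> powr p) < (\<Sum>j<n. \<bar>w j\<bar> powr p)"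
    by (rule sum_strict_mono) (use assms in \<open>fastforce intro!: powr_less_mono2\<close>)+
  then show ?thesis unfolding pnorm_def using assms
    by (intro powr_less_mono2) (auto intro: sum_nonneg)
qed

lemma tidx_finite: "finite (tidx m d)"
  by (simp add: tidx_def finite_PiE)

lemma tidx_less: "J \<in> tidx m d \<Longrightarrow> k < m \<Longrightarrow> J k < d k"
  by (auto simp: tidx_def)

lemma grad_cong:
  assumes "\<And>l j. l < m \<Longrightarrow> l \<noteq> k \<Longrightarrow> j < d l \<Longrightarrow> x l j = y l j"
  shows "grad m d f k x = grad m d f k y"
proof
  fix j
  show "grad m d f k x j = grad m d f k y j"
    unfolding grad_def using assms
    by (intro sum.cong refl arg_cong2[where f="(*)"] prod.cong) (auto simp: tidx_less)
qed

lemma grad_scale: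
  "grad m d f k (\<lambda>l j. c l * y l j) j = (\<Prod>l\<in>{..<m} - {k}. c l) * grad m d f k y j"
  by (simp add: grad_def prod.distrib sum_distrib_left mult_ac)

lemma grad_mono:
  assumes "nonneg_tensor m d f"
    and "\<And>l j. l < m \<Longrightarrow> l \<noteq> k \<Longrightarrow> j < d l \<Longrightarrow> 0 \<le> x l j \<and> x l j \<le> y l j"
  shows "grad m d f k x j \<le> grad m d f k y j"
  unfolding grad_def
  by (intro sum_mono mult_left_mono prod_mono)
    (use assms in \<open>auto simp: nonneg_tensor_def tidx_less\<close>)

text \<open>Equal sums of termwise ordered summands have equal summands; the coefficient
  \<open>f J > 0\<close> cancels, and equal products of ordered positive factors have equal factors.
  The equality case of the nonlinear comparison goes back to this.\<close>

lemma grad_eq_imp_eq: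
  assumes nn: "nonneg_tensor m d f"
    and le: "\<And>l j. l < m \<Longrightarrow> l \<noteq> k \<Longrightarrow> j < d l \<Longrightarrow> 0 < x l j \<and> x l j \<le> y l j"
    and eq: "grad m d f k x (J k) = grad m d f k y (J k)"
    and J: "J \<in> tidx m d" "0 < f J" and l: "l < m" "l \<noteq> k"
  shows "x l (J l) = y l (J l)"
proof -
  have "f J * (\<Prod>l\<in>{..<m} - {k}. x l (J l)) = f J * (\<Prod>l\<in>{..<m} - {k}. y l (J l))"
  proof (rule sum_eq_imp_eq[where A = "{J' \<in> tidx m d. J' k = J k}" and a = J
        and x = "\<lambda>J. f J * (\<Prod>l\<in>{..<m} - {k}. x l (J l))"
        and y = "\<lambda>J. f J * (\<Prod>l\<in>{..<m} - {k}. y l (J l))"])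
    show "finite {J' \<in> tidx m d. J' k = J k}" by (simp add: tidx_finite)
    show "sum (\<lambda>J. f J * (\<Prod>l\<in>{..<m} - {k}. x l (J l))) {J' \<in> tidx m d. J' k = J k} =
      sum (\<lambda>J. f J * (\<Prod>l\<in>{..<m} - {k}. y l (J l))) {J' \<in> tidx m d. J' k = J k}"
      using eq by (simp add: grad_def)
    show "J \<in> {J' \<in> tidx m d. J' k = J k}" using J by simp
  next
    fix J' assume "J' \<in> {J' \<in> tidx m d. J' k = J k}"
    then show "f J' * (\<Prod>l\<in>{..<m} - {k}. x l (J' l)) \<le> f J' * (\<Prod>l\<in>{..<m} - {k}. y l (J' l))"
      using nn le by (intro mult_left_mono prod_mono)
        (auto simp: nonneg_tensor_def tidx_less intro: less_imp_le)
  qed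
  then have "(\<Prod>l\<in>{..<m} - {k}. x l (J l)) = (\<Prod>l\<in>{..<m} - {k}. y l (J l))" using J by simp
  from prod_eq_imp_eq[OF _ _ this, of l] show ?thesis using le l J by (auto simp: tidx_less)
qed

section \<open>Propagation along positive entries\<close>

locale irreducible_tensor =
  fixes m :: nat and d :: "nat \<Rightarrow> nat" and f :: "(nat \<Rightarrow> nat) \<Rightarrow> real"
  assumes m2: "2 \<le> m"
    and d_pos: "k < m \<Longrightarrow> 0 < d k"
    and nonneg: "nonneg_tensor m d f"
    and wirr: "weakly_irreducible m d f"
begin

lemma f_nonneg: "J \<in> tidx m d \<Longrightarrow> 0 \<le> f J"
  using nonneg by (simp add: nonneg_tensor_def)

text \<open>Weak irreducibility gives a path from \<open>(k, j)\<close> to a vertex of another mode,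
  and its first edge is carried by a positive entry.\<close>

lemma vertex_covered:
  assumes "k < m" "j < d k"
  shows "\<exists>J\<in>tidx m d. 0 < f J \<and> J k = j"
proof -
  obtain k' where k': "k' < m" "k' \<noteq> k" using m2
    by (metis One_nat_def Suc_1 Suc_le_lessD less_trans zero_less_one zero_neq_one)
  have "(wi_adj m d f)\<^sup>*\<^sup>* (k, j) (k', 0)"
    using wirr assms k' d_pos unfolding weakly_irreducible_def by auto
  then obtain u where "wi_adj m d f (k, j) u"
    using k' by (cases rule: converse_rtranclpE) auto
  then show ?thesis by (auto simp: wi_adj_def)
qed

lemma connected_modes:
  assumes step: "\<And>J k l. J \<in> tidx m d \<Longrightarrow> 0 < f J \<Longrightarrow> k < m \<Longrightarrow> l < m \<Longrightarrow> P k (J k) \<Longrightarrow> P l (J l)"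
    and base: "P k0 j0" "k0 < m" "j0 < d k0" and kj: "k < m" "j < d k"
  shows "P k j"
proof -
  have "(wi_adj m d f)\<^sup>*\<^sup>* (k0, j0) (k, j)"
    using wirr base kj unfolding weakly_irreducible_def by auto
  then have "case_prod P (k, j)"
  proof (induction rule: rtranclp_induct)
    case base
    then show ?case using assms(2) by simp
  next
    case (step u v)
    then obtain J where "J \<in> tidx m d" "0 < f J" "J (fst u) = snd u" "J (fst v) = snd v"
      "fst u < m" "fst v < m" by (auto simp: wi_adj_def)
    then show ?case using assms(1)[of J "fst u" "fst v"] step.IH by (simp add: case_prod_beta)
  qed
  then show ?thesis by simp
qed

text \<open>Mode \<open>i\<close> is eliminated by the iteration, so equality information passes
  between positive entries that agree in mode \<open>i\<close>, not only within one entry.\<close>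

lemma connected_through_mode:
  assumes step: "\<And>J J' l k. J \<in> tidx m d \<Longrightarrow> 0 < f J \<Longrightarrow> J' \<in> tidx m d \<Longrightarrow> 0 < f J' \<Longrightarrow> J' i = J i \<Longrightarrow>
      l < m \<Longrightarrow> l \<noteq> i \<Longrightarrow> k < m \<Longrightarrow> k \<noteq> i \<Longrightarrow> P l (J l) \<Longrightarrow> P k (J' k)"
    and base: "P k0 j0" "k0 < m" "k0 \<noteq> i" "j0 < d k0" and kj: "k < m" "k \<noteq> i" "j < d k"
  shows "P k j"
proof -
  \<comment> \<open>\<open>P'\<close> extends \<open>P\<close> to mode \<open>i\<close>: a vertex
    there is good when all positive entries through it have good coordinates elsewhere. This makes
    \<open>connected_modes\<close> applicable.\<close>
  define P' where "P' = (\<lambda>k j. if k = i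
    then \<forall>J\<in>tidx m d. 0 < f J \<and> J i = j \<longrightarrow> (\<forall>k<m. k \<noteq> i \<longrightarrow> P k (J k)) else P k j)"
  have "P' k j"
  proof (rule connected_modes[of P' k0 j0])
    fix J k l assume *: "J \<in> tidx m d" "0 < f J" "k < m" "l < m" "P' k (J k)"
    show "P' l (J l)"
    proof (cases "k = i")
      case True
      then have "\<forall>k<m. k \<noteq> i \<longrightarrow> P k (J k)" using * by (auto simp: P'_def)
      then show ?thesis using * True by (auto simp: P'_def)
    next
      case False
      then have "P k (J k)" using * by (simp add: P'_def)
      then show ?thesis using * False step[of J _ k] by (auto simp: P'_def)
    qed
  qed (use base kj in \<open>auto simp: P'_def\<close>)
  then show ?thesis using kj by (simp add: P'_def)
qed

lemma grad_pos:
  assumes "k < m" "j < d k" and pos: "\<And>l j. l < m \<Longrightarrow> l \<noteq> k \<Longrightarrow> j < d l \<Longrightarrow> 0 < x l j"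
  shows "0 < grad m d f k x j"
proof -
  obtain J where J: "J \<in> tidx m d" "0 < f J" "J k = j" using vertex_covered assms by blast
  show ?thesis unfolding grad_def
  proof (rule sum_pos2[of _ J])
    show "0 < f J * (\<Prod>l\<in>{..<m} - {k}. x l (J l))"
      using J pos by (intro mult_pos_pos prod_pos) (auto simp: tidx_less)
    show "0 \<le> f J' * (\<Prod>l\<in>{..<m} - {k}. x l (J' l))" if "J' \<in> {J \<in> tidx m d. J k = j}" for J'
      using that pos by (intro mult_nonneg_nonneg prod_nonneg)
        (auto simp: tidx_less f_nonneg intro: less_imp_le)
  qed (use J in \<open>auto simp: tidx_finite\<close>)
qed

end

section \<open>The comparison principle\<close>

text \<open>The analysis is carried out for a positive normalised solution of \<open>eigen\<close>;
  the theorem later checks that the given singular vector is one, with \<open>lam\<close> its value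
  under the form.\<close>

locale hgpm_setting = irreducible_tensor m d f for m d f +
  fixes p :: "nat \<Rightarrow> real" and i :: nat and xt :: "nat \<Rightarrow> nat \<Rightarrow> real" and lam :: real
  assumes i_less: "i < m"
    and p_gt1: "k < m \<Longrightarrow> 1 < p k"
    and p_large: "k < m \<Longrightarrow> k \<noteq> i \<Longrightarrow> real (m - 1) * conj_exp (p i) \<le> p k"
    and xt_pos: "k < m \<Longrightarrow> j < d k \<Longrightarrow> 0 < xt k j"
    and xt_norm: "k < m \<Longrightarrow> pnorm (p k) (d k) (xt k) = 1"
    and lam_pos: "0 < lam"
    and eigen: "k < m \<Longrightarrow> j < d k \<Longrightarrow> grad m d f k xt j = lam * xt k j powr (p k - 1)"
begin

abbreviation "K \<equiv> {..<m} - {i}"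
abbreviation "S x \<equiv> \<lambda>l. s_map m d f p i l x"
abbreviation "T \<equiv> hgpm_step m d f p i"

definition "q = conj_exp (p i)"
definition "b l = p l - 1"
definition "\<kappa> = real (m - 1) * q - 1"
text \<open>For positive \<open>x\<close> the inserted block is, up to scaling, the maximiser in
  mode \<open>i\<close> with the other blocks held fixed (equality case of Hoelder).\<close>

definition "ext x = x(i := psi q (grad m d f i x))"
definition "pos_pt x \<longleftrightarrow> (\<forall>l\<in>K. \<forall>j<d l. 0 < x l j)" for x :: "nat \<Rightarrow> nat \<Rightarrow> real"
definition "normalized x \<longleftrightarrow> (\<forall>l\<in>K. pnorm (p l) (d l) (x l) = 1)"
text \<open>For positive blocks this is the least factor c with \<open>x l\<close> <= c *
  \<open>y l\<close>; the logarithm of \<open>mx l x y * mx l y x\<close> is Hilbert's projective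
  distance of the two blocks.\<close>

definition "mx l x y = Max ((\<lambda>j. x l j / y l j) ` {..<d l})" for x y :: "nat \<Rightarrow> nat \<Rightarrow> real"

lemma q_gt1: "1 < q" and q_conj: "(p i - 1) * (q - 1) = 1"
  using p_gt1[OF i_less] by (auto simp: q_def conj_exp_def field_simps)

lemma b_pos: "l \<in> K \<Longrightarrow> 0 < b l"
  using p_gt1 by (auto simp: b_def)

lemma kappa_le_b: "l \<in> K \<Longrightarrow> \<kappa> \<le> b l"
  using p_large by (auto simp: b_def \<kappa>_def q_def)

lemma card_K: "card K = m - 1" and K_nonempty: "K \<noteq> {}"
proof -
  show *: "card K = m - 1" using i_less by simp
  show "K \<noteq> {}" using * m2 by force
qed

lemma pos_pt_xt: "pos_pt xt" and normalized_xt: "normalized xt"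
  using xt_pos xt_norm by (auto simp: pos_pt_def normalized_def)

lemma ext_other: "l \<noteq> i \<Longrightarrow> ext x l = x l"
  by (simp add: ext_def)

lemma grad_i_pos: "pos_pt x \<Longrightarrow> t < d i \<Longrightarrow> 0 < grad m d f i x t"
  by (rule grad_pos) (auto simp: i_less pos_pt_def)

lemma ext_i: "pos_pt x \<Longrightarrow> t < d i \<Longrightarrow> ext x i t = grad m d f i x t powr (q - 1)"
  using grad_i_pos[of x t] by (simp add: ext_def psi_def)

lemma ext_pos: "pos_pt x \<Longrightarrow> l < m \<Longrightarrow> j < d l \<Longrightarrow> 0 < ext x l j"
  using grad_i_pos[of x j] by (cases "l = i") (auto simp: ext_i ext_other pos_pt_def[of x])

lemma grad_ext_pos: "pos_pt x \<Longrightarrow> l \<in> K \<Longrightarrow> j < d l \<Longrightarrow> 0 < grad m d f l (ext x) j"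
  by (rule grad_pos) (auto simp: ext_pos)

lemma S_eq: "pos_pt x \<Longrightarrow> l \<in> K \<Longrightarrow> j < d l \<Longrightarrow> S x l j = grad m d f l (ext x) j powr (1 / b l)"
proof -
  assume *: "pos_pt x" "l \<in> K" "j < d l"
  have "conj_exp (p l) - 1 = 1 / b l"
    using b_pos[OF *(2)] by (simp add: conj_exp_def b_def field_simps)
  then show ?thesis using grad_ext_pos[OF *] by (simp add: s_map_def psi_def ext_def q_def)
qed

lemma S_pos: "pos_pt x \<Longrightarrow> l \<in> K \<Longrightarrow> j < d l \<Longrightarrow> 0 < S x l j"
  using grad_ext_pos[of x l j] by (subst S_eq) auto

lemma pos_pt_S: "pos_pt x \<Longrightarrow> pos_pt (S x)"
  using S_pos by (auto simp: pos_pt_def)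

section \<open>Comparison of the images under S of blockwise ordered points, with its equality
  case\<close>

context
  fixes x y :: "nat \<Rightarrow> nat \<Rightarrow> real" and c :: "nat \<Rightarrow> real"
  assumes x: "pos_pt x" and y: "pos_pt y" and c: "\<And>l. l \<in> K \<Longrightarrow> 0 < c l"
    and le: "\<And>l j. l \<in> K \<Longrightarrow> j < d l \<Longrightarrow> x l j \<le> c l * y l j"
begin

text \<open>\<open>C\<close> is the factor gained by the gradient in mode \<open>i\<close>. The
  power \<open>q - 1\<close> in \<open>ext\<close> turns it into the factor of block
  \<open>i\<close>, so \<open>c'\<close> lists the block factors of the completed points.\<close>

private definition "C = (\<Prod>k\<in>K. c k)"
private definition "c' = c(i := C powr (q - 1))"

private lemma C_pos: "0 < C"
  unfolding C_def by (intro prod_pos) (use c in auto)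

private lemma grad_i_scaled: "grad m d f i (\<lambda>l j. c l * y l j) t = C * grad m d f i y t"
  by (simp add: grad_scale C_def)

private lemma grad_i_le: "grad m d f i x t \<le> C * grad m d f i y t"
  unfolding grad_i_scaled[symmetric]
  by (rule grad_mono[OF nonneg]) (use x le in \<open>auto simp: pos_pt_def intro: less_imp_le\<close>)

private lemma ext_le: "l < m \<Longrightarrow> j < d l \<Longrightarrow> ext x l j \<le> c' l * ext y l j"
proof (cases "l = i")
  case True
  assume "j < d l"
  then have j: "j < d i" using True by simp
  have "grad m d f i x j powr (q - 1) \<le> (C * grad m d f i y j) powr (q - 1)"
    using grad_i_le q_gt1 grad_i_pos[OF x j] by (intro powr_mono2) auto
  then show ?thesis
    using True j x y C_pos grad_i_pos[OF y j] by (simp add: ext_i c'_def powr_mult)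
next
  case False
  assume "l < m" "j < d l"
  then show ?thesis using False le by (simp add: ext_other c'_def)
qed

private lemma prod_c':
  assumes l: "l \<in> K"
  shows "(\<Prod>k\<in>{..<m} - {l}. c' k) = C powr q / c l"
proof -
  have eq: "{..<m} - {l} = insert i (K - {l})" using l i_less by auto
  have "(\<Prod>k\<in>{..<m} - {l}. c' k) = c' i * (\<Prod>k\<in>K - {l}. c' k)"
    unfolding eq by simp
  also have "(\<Prod>k\<in>K - {l}. c' k) = (\<Prod>k\<in>K - {l}. c k)"
    by (intro prod.cong) (auto simp: c'_def)
  also have "(\<Prod>k\<in>K - {l}. c k) = C / c l"
    unfolding C_def using l c[OF l] by (subst prod.remove[of K l]) auto
  also have "c' i * (C / c l) = C powr q / c l"
    using C_pos by (simp add: c'_def powr_diff)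
  finally show ?thesis .
qed

private lemma grad_l_scaled: "l \<in> K \<Longrightarrow>
    grad m d f l (\<lambda>k j. c' k * ext y k j) j = C powr q / c l * grad m d f l (ext y) j"
  by (simp add: grad_scale prod_c')

private lemma grad_l_le: "l \<in> K \<Longrightarrow> grad m d f l (ext x) j \<le> C powr q / c l * grad m d f l (ext y) j"
  unfolding grad_l_scaled[symmetric]
  by (rule grad_mono[OF nonneg]) (use ext_pos[OF x] ext_le in \<open>auto intro: less_imp_le\<close>)

private lemma S_bound_eq:
  assumes "l \<in> K" "j < d l"
  shows "(C powr q / c l) powr (1 / b l) * S y l j = (C powr q / c l * grad m d f l (ext y) j) powr (1 / b l)"
  unfolding S_eq[OF y assms] using C_pos c[OF assms(1)] grad_ext_pos[OF y assms]
  by (intro powr_mult[symmetric])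

text \<open>The gradient in mode \<open>l\<close> does not see block \<open>l\<close>, so it
  collects all block factors except \<open>c l\<close>: in total
  \<open>C * C powr (q - 1) / c l\<close>. The root \<open>1 / b l\<close> comes from
  \<open>psi\<close>.\<close>

lemma S_compare:
  assumes "l \<in> K" "j < d l"
  shows "S x l j \<le> ((\<Prod>k\<in>K. c k) powr q / c l) powr (1 / b l) * S y l j"
  unfolding C_def[symmetric] S_bound_eq[OF assms] S_eq[OF x assms]
  using grad_l_le[OF assms(1)] grad_ext_pos[OF x assms] b_pos[OF assms(1)]
  by (intro powr_mono2) (auto intro: less_imp_le)

text \<open>Equality travels in two stages: through the gradient in mode \<open>l\<close> to
  coordinate \<open>J i\<close> of the completed point, and from there through the gradient in mode
  \<open>i\<close> to every positive entry \<open>J'\<close> with the same index in mode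
  \<open>i\<close>.\<close>

lemma S_compare_eq:
  assumes l: "l \<in> K" and J: "J \<in> tidx m d" "0 < f J" and J': "J' \<in> tidx m d" "0 < f J'" "J' i = J i"
    and k: "k \<in> K"
    and eq: "S x l (J l) = ((\<Prod>k\<in>K. c k) powr q / c l) powr (1 / b l) * S y l (J l)"
  shows "x k (J' k) = c k * y k (J' k)"
proof -
  have jl: "J l < d l" and ji: "J i < d i" using J l i_less by (auto simp: tidx_less)
  have "grad m d f l (ext x) (J l) powr (1 / b l) = (C powr q / c l * grad m d f l (ext y) (J l)) powr (1 / b l)"
    using eq unfolding C_def[symmetric] S_bound_eq[OF l jl] S_eq[OF x l jl] .
  \<comment> \<open>Undoing the root gives equality between the gradients themselves.\<close>
  then have "(grad m d f l (ext x) (J l) powr (1 / b l)) powr b l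
     = ((C powr q / c l * grad m d f l (ext y) (J l)) powr (1 / b l)) powr b l" by simp
  then have "grad m d f l (ext x) (J l) = grad m d f l (\<lambda>k j. c' k * ext y k j) (J l)"
    unfolding grad_l_scaled[OF l]
    using b_pos[OF l] grad_ext_pos[OF x l jl] grad_ext_pos[OF y l jl] C_pos c[OF l]
    by (simp add: powr_powr)
  from grad_eq_imp_eq[OF nonneg _ this J, of i]
  have "ext x i (J i) = c' i * ext y i (J i)"
    using i_less l ext_pos[OF x] ext_le by auto
  then have "grad m d f i x (J i) powr (q - 1) = (C * grad m d f i y (J i)) powr (q - 1)"
    using x y ji C_pos grad_i_pos[OF y ji] by (simp add: ext_i c'_def powr_mult)
  then have "(grad m d f i x (J i) powr (q - 1)) powr (1 / (q - 1))
      = ((C * grad m d f i y (J i)) powr (q - 1)) powr (1 / (q - 1))" by simp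
  then have "grad m d f i x (J' i) = grad m d f i (\<lambda>l j. c l * y l j) (J' i)"
    unfolding grad_i_scaled J'(3)
    using q_gt1 C_pos grad_i_pos[OF y ji] grad_i_pos[OF x ji] by (simp add: powr_powr)
  from grad_eq_imp_eq[OF nonneg _ this J'(1,2), of k]
  show ?thesis using k x le by (auto simp: pos_pt_def)
qed

end

section \<open>Maximal ratios and the functional D\<close>

lemma d_pos': "l \<in> K \<Longrightarrow> 0 < d l"
  using d_pos by simp

lemma mx_ge: "j < d l \<Longrightarrow> x l j / y l j \<le> mx l x y"
  unfolding mx_def by (intro Max_ge) auto

lemma mx_attained: "l \<in> K \<Longrightarrow> \<exists>j<d l. x l j / y l j = mx l x y"
proof -
  assume "l \<in> K"
  then have "mx l x y \<in> (\<lambda>j. x l j / y l j) ` {..<d l}"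
    unfolding mx_def using d_pos' by (intro Max_in) auto
  then show ?thesis by auto
qed

lemma mx_pos: "pos_pt x \<Longrightarrow> pos_pt y \<Longrightarrow> l \<in> K \<Longrightarrow> 0 < mx l x y"
  using mx_attained[of l x y] by (metis pos_pt_def divide_pos_pos)

lemma le_mx: "pos_pt y \<Longrightarrow> l \<in> K \<Longrightarrow> j < d l \<Longrightarrow> x l j \<le> mx l x y * y l j"
  using mx_ge[of j l x y] by (auto simp: pos_pt_def divide_le_eq)

lemma mx_scale:
  assumes "l \<in> K" "0 < s" "0 < t"
    and "\<And>j. j < d l \<Longrightarrow> x' l j = s * x l j" "\<And>j. j < d l \<Longrightarrow> y' l j = t * y l j"
  shows "mx l x' y' = s / t * mx l x y"
proof -
  have eq: "x' l j / y' l j = s / t * (x l j / y l j)" if "j < d l" for j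
    using assms that by simp
  obtain j1 where j1: "j1 < d l" "x l j1 / y l j1 = mx l x y" using mx_attained assms by blast
  obtain j2 where j2: "j2 < d l" "x' l j2 / y' l j2 = mx l x' y'" using mx_attained assms by blast
  show ?thesis
  proof (rule antisym)
    show "mx l x' y' \<le> s / t * mx l x y"
      using eq[OF j2(1)] mx_ge[OF j2(1), of x y] assms(2,3) j2(2)
      by (metis divide_pos_pos less_imp_le mult_left_mono)
    show "s / t * mx l x y \<le> mx l x' y'"
      using eq[OF j1(1)] mx_ge[OF j1(1), of x' y'] j1(2) by metis
  qed
qed

text \<open>Two normalised blocks cannot be strictly ordered, as the norm is strictly monotone on
  positive vectors. Hence the logarithms in \<open>D\<close> are nonnegative, which is what allows
  \<open>\<kappa> \<le> b l\<close> to be applied termwise.\<close>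

lemma mx_normalized:
  assumes "pos_pt x" "pos_pt y" "normalized x" "normalized y" "l \<in> K"
  shows "1 \<le> mx l x y"
proof (rule ccontr)
  assume "\<not> 1 \<le> mx l x y"
  have "x l j < y l j" if "j < d l" for j
  proof -
    have "x l j / y l j < 1" using mx_ge[OF that, of x y] \<open>\<not> 1 \<le> mx l x y\<close> by simp
    then show ?thesis using assms that by (auto simp: pos_pt_def)
  qed
  then have "pnorm (p l) (d l) (x l) < pnorm (p l) (d l) (y l)"
    using assms d_pos' p_gt1[of l] by (intro pnorm_strict_mono) (auto simp: pos_pt_def)
  then show False using assms by (simp add: normalized_def)
qed

text \<open>This is \<open>S_compare\<close> with the factors \<open>mx l x y\<close>, in
  logarithmic form. The second claim puts the equality case into the shape that
  \<open>S_compare_eq\<close> takes.\<close>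

lemma ln_mx_S:
  assumes x: "pos_pt x" and y: "pos_pt y" and l: "l \<in> K"
  shows "b l * ln (mx l (S x) (S y)) \<le> q * (\<Sum>k\<in>K. ln (mx k x y)) - ln (mx l x y)"
    and "b l * ln (mx l (S x) (S y)) = q * (\<Sum>k\<in>K. ln (mx k x y)) - ln (mx l x y) \<longleftrightarrow>
      mx l (S x) (S y) = ((\<Prod>k\<in>K. mx k x y) powr q / mx l x y) powr (1 / b l)"
proof -
  let ?B = "((\<Prod>k\<in>K. mx k x y) powr q / mx l x y) powr (1 / b l)"
  have C: "0 < (\<Prod>k\<in>K. mx k x y)" by (intro prod_pos) (use mx_pos x y in auto)
  have M: "0 < mx k x y" if "k \<in> K" for k using mx_pos x y that by auto
  have lnC: "ln (\<Prod>k\<in>K. mx k x y) = (\<Sum>k\<in>K. ln (mx k x y))"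
    by (rule ln_prod) (simp, metis M less_irrefl)
  have "0 < (z powr q / y) powr (1 / b l)" if "0 < z" "0 < y" for y z :: real
    using that by simp
  from this[OF C M[OF l]] have B: "0 < ?B" .
  have lnB: "b l * ln ?B = q * (\<Sum>k\<in>K. ln (mx k x y)) - ln (mx l x y)"
  proof -
    have "b l * ln ((z powr q / y) powr (1 / b l)) = q * ln z - ln y" if "0 < z" "0 < y" for y z :: real
      using b_pos[OF l] that by (simp add: ln_powr ln_div)
    from this[OF C M[OF l]] show ?thesis unfolding lnC .
  qed
  obtain j where j: "j < d l" "S x l j / S y l j = mx l (S x) (S y)"
    using mx_attained[OF l, of "S x" "S y"] by blast
  have "S x l j \<le> ?B * S y l j"
    by (rule S_compare) (use x y l j mx_pos le_mx in auto)
  then have le: "mx l (S x) (S y) \<le> ?B"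
    using j S_pos[OF y l j(1)] by (simp add: divide_le_eq flip: j(2))
  have P: "0 < mx l (S x) (S y)" using mx_pos[OF pos_pt_S pos_pt_S] x y l by auto
  show "b l * ln (mx l (S x) (S y)) \<le> q * (\<Sum>k\<in>K. ln (mx k x y)) - ln (mx l x y)"
    unfolding lnB[symmetric] using ln_le_cancel_iff[OF P B] le b_pos[OF l] by (intro mult_left_mono) (blast intro: less_imp_le)+
  show "b l * ln (mx l (S x) (S y)) = q * (\<Sum>k\<in>K. ln (mx k x y)) - ln (mx l x y) \<longleftrightarrow> mx l (S x) (S y) = ?B"
    unfolding lnB[symmetric] using P B b_pos[OF l] by (metis less_numeral_extra(3) ln_inj_iff mult_left_cancel)
qed

text \<open>The weights \<open>b l\<close> cancel the roots \<open>1 / b l\<close> in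
  \<open>S\<close>. After summation over \<open>l\<close>, each \<open>ln (mx k x y)\<close> occurs
  \<open>m - 1\<close> times with factor \<open>q\<close> and once with factor -1, which is the
  origin of \<open>\<kappa>\<close>.\<close>

definition "D x y = (\<Sum>l\<in>K. b l * ln (mx l x y))" for x y :: "nat \<Rightarrow> nat \<Rightarrow> real"

lemma sum_ln_mx: "(\<Sum>l\<in>K. q * (\<Sum>k\<in>K. ln (mx k x y)) - ln (mx l x y)) = \<kappa> * (\<Sum>k\<in>K. ln (mx k x y))"
  using card_K by (simp add: sum_subtractf \<kappa>_def algebra_simps)

lemma D_S_le:
  assumes "pos_pt x" "pos_pt y"
  shows "D (S x) (S y) \<le> \<kappa> * (\<Sum>k\<in>K. ln (mx k x y))"
  unfolding D_def sum_ln_mx[symmetric] by (intro sum_mono ln_mx_S assms)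

lemma kappa_sum_le_D:
  assumes "pos_pt x" "pos_pt y" "normalized x" "normalized y"
  shows "\<kappa> * (\<Sum>k\<in>K. ln (mx k x y)) \<le> D x y"
  unfolding D_def sum_distrib_left
  by (intro sum_mono mult_right_mono kappa_le_b) (use assms mx_normalized in auto)

lemma D_nonneg:
  assumes "pos_pt x" "pos_pt y" "normalized x" "normalized y"
  shows "0 \<le> D x y"
  unfolding D_def using b_pos mx_normalized[OF assms]
  by (intro sum_nonneg mult_nonneg_nonneg) (auto intro: less_imp_le)

end

section \<open>Monotone bounds and global convergence\<close>

context hgpm_setting
begin

definition "nrm l x = pnorm (p l) (d l) (S x l)"

lemma nrm_pos: "pos_pt x \<Longrightarrow> l \<in> K \<Longrightarrow> 0 < nrm l x"
  unfolding nrm_def using d_pos' S_pos by (intro pnorm_pos) auto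

lemma T_eq: "l \<in> K \<Longrightarrow> j < d l \<Longrightarrow> T x l j = S x l j / nrm l x"
  by (simp add: hgpm_step_def restr_def nrm_def)

lemma pos_pt_T: "pos_pt x \<Longrightarrow> pos_pt (T x)"
  unfolding pos_pt_def[of "T x"] using S_pos nrm_pos by (auto simp: T_eq)

lemma normalized_T:
  assumes "pos_pt x"
  shows "normalized (T x)"
  unfolding normalized_def
proof
  fix l assume l: "l \<in> K"
  have "pnorm (p l) (d l) (T x l) = pnorm (p l) (d l) (\<lambda>j. S x l j / nrm l x)"
    by (intro pnorm_cong T_eq l)
  also have "\<dots> = 1"
    using nrm_pos[OF assms l] p_gt1[of l] l by (subst pnorm_divide) (auto simp flip: nrm_def)
  finally show "pnorm (p l) (d l) (T x l) = 1" .
qed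

text \<open>The completion inverts the power in the eigenvalue equation, because
  \<open>(p i - 1) * (q - 1) = 1\<close>.\<close>

lemma ext_xt_i: "t < d i \<Longrightarrow> ext xt i t = lam powr (q - 1) * xt i t"
  using xt_pos[OF i_less, of t] lam_pos q_conj
  by (simp add: ext_i pos_pt_xt eigen[OF i_less] powr_mult powr_powr)

lemma grad_ext_xt:
  assumes "l \<in> K" "j < d l"
  shows "grad m d f l (ext xt) j = lam powr (q - 1) * grad m d f l xt j"
proof -
  let ?c = "(\<lambda>k. 1)(i := lam powr (q - 1))"
  have "grad m d f l (ext xt) = grad m d f l (\<lambda>k j. ?c k * xt k j)"
    by (rule grad_cong) (auto simp: ext_other ext_xt_i)
  then have "grad m d f l (ext xt) j = (\<Prod>k\<in>{..<m} - {l}. ?c k) * grad m d f l xt j"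
    by (simp add: grad_scale)
  also have "(\<Prod>k\<in>{..<m} - {l}. ?c k) = lam powr (q - 1)"
    using assms i_less by (subst prod.remove[of _ i]) (auto intro!: prod.neutral)
  finally show ?thesis .
qed

lemma S_xt:
  assumes "l \<in> K" "j < d l"
  shows "S xt l j = lam powr (q / b l) * xt l j"
proof -
  have x: "0 < xt l j" using xt_pos assms by simp
  \<comment> \<open>One factor \<open>lam powr (q - 1)\<close> comes from the completed block, one
    factor \<open>lam\<close> from the eigenvalue equation.\<close>
  have "grad m d f l (ext xt) j = lam powr q * xt l j powr b l"
    using assms lam_pos by (simp add: grad_ext_xt eigen b_def powr_diff)
  then show ?thesis
    using assms x lam_pos b_pos[OF assms(1)] by (simp add: S_eq pos_pt_xt powr_mult powr_powr)
qed

lemma T_xt: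
  assumes "l \<in> K" "j < d l"
  shows "T xt l j = xt l j"
proof -
  let ?c = "lam powr (q / b l)"
  have "nrm l xt = pnorm (p l) (d l) (\<lambda>j. xt l j / (1 / ?c))"
    unfolding nrm_def by (intro pnorm_cong) (use assms S_xt in auto)
  also have "\<dots> = ?c"
    using p_gt1[of l] assms lam_pos xt_norm[of l] by (subst pnorm_divide) auto
  finally show ?thesis using assms lam_pos by (simp add: T_eq S_xt)
qed

lemma mx_cong:
  assumes "\<And>j. j < d l \<Longrightarrow> x l j = x' l j" "\<And>j. j < d l \<Longrightarrow> y l j = y' l j"
  shows "mx l x y = mx l x' y'"
  unfolding mx_def by (intro arg_cong[where f=Max] image_cong) (use assms in auto)

lemma D_cong:
  assumes "\<And>l j. l \<in> K \<Longrightarrow> j < d l \<Longrightarrow> x l j = x' l j"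
    "\<And>l j. l \<in> K \<Longrightarrow> j < d l \<Longrightarrow> y l j = y' l j"
  shows "D x y = D x' y'"
  unfolding D_def using mx_cong[of _ x x' y y'] assms by (intro sum.cong) auto

lemma D_xt_xt: "D xt xt = 0"
proof -
  have "mx l xt xt = 1" if "l \<in> K" for l
    using mx_attained[OF that, of xt xt] xt_pos[of l] that by fastforce
  then show ?thesis by (simp add: D_def)
qed

text \<open>Block factors enter with opposite signs in the two arguments. Normalisation can thus be
  tracked exactly, and its effect cancels in the symmetrised \<open>V\<close>.\<close>

lemma D_scale:
  assumes "\<And>l. l \<in> K \<Longrightarrow> 0 < s l" "\<And>l. l \<in> K \<Longrightarrow> 0 < t l" "pos_pt x" "pos_pt y"
    and "\<And>l j. l \<in> K \<Longrightarrow> j < d l \<Longrightarrow> x' l j = s l * x l j"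
    and "\<And>l j. l \<in> K \<Longrightarrow> j < d l \<Longrightarrow> y' l j = t l * y l j"
  shows "D x' y' = D x y + (\<Sum>l\<in>K. b l * (ln (s l) - ln (t l)))"
proof -
  have "b l * ln (mx l x' y') = b l * ln (mx l x y) + b l * (ln (s l) - ln (t l))" if "l \<in> K" for l
  proof -
    have "mx l x' y' = s l / t l * mx l x y" by (rule mx_scale) (use that assms in auto)
    then show ?thesis using assms(1,2)[OF that] mx_pos[OF assms(3,4) that]
      by (simp add: ln_mult ln_div algebra_simps)
  qed
  then show ?thesis unfolding D_def by (simp add: sum.distrib)
qed

lemma D_T:
  assumes "pos_pt x" "pos_pt y"
  shows "D (T x) (T y) = D (S x) (S y) + (\<Sum>l\<in>K. b l * (ln (nrm l y) - ln (nrm l x)))"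
proof -
  have "D (T x) (T y) = D (S x) (S y) + (\<Sum>l\<in>K. b l * (ln (1 / nrm l x) - ln (1 / nrm l y)))"
    by (rule D_scale) (use assms in \<open>auto simp: nrm_pos pos_pt_S T_eq\<close>)
  also have "(\<Sum>l\<in>K. b l * (ln (1 / nrm l x) - ln (1 / nrm l y))) =
     (\<Sum>l\<in>K. b l * (ln (nrm l y) - ln (nrm l x)))"
    using assms nrm_pos by (intro sum.cong refl) (simp add: ln_div)
  finally show ?thesis .
qed

text \<open>Both quotients differ by the same amount \<open>?n\<close> from a comparison of
  consecutive iterates: \<open>D (S (T x)) (S x)\<close> on the left and \<open>D (T x) x\<close> on
  the right. The comparison principle for the pair \<open>T x\<close>, \<open>x\<close> then
  decides.\<close>

lemma upper_quotient_decreasing: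
  assumes "pos_pt x" "normalized x"
  shows "D (S (T x)) (T x) \<le> D (S x) x"
proof -
  have T: "pos_pt (T x)" "normalized (T x)" using pos_pt_T normalized_T assms by auto
  let ?n = "\<Sum>l\<in>K. b l * ln (nrm l x)"
  have "D (S (T x)) (T x) = D (S (T x)) (S x) + (\<Sum>l\<in>K. b l * (ln 1 - ln (1 / nrm l x)))"
    by (rule D_scale) (use assms T in \<open>auto simp: nrm_pos pos_pt_S T_eq\<close>)
  moreover have "(\<Sum>l\<in>K. b l * (ln 1 - ln (1 / nrm l x))) = ?n"
    using assms nrm_pos by (intro sum.cong refl) (simp add: ln_div)
  moreover have "D (S (T x)) (S x) \<le> D (T x) x"
    using D_S_le[OF T(1) assms(1)] kappa_sum_le_D[OF T(1) assms(1) T(2) assms(2)] by linarith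
  moreover have "D (S x) x = D (T x) x + (\<Sum>l\<in>K. b l * (ln (nrm l x) - ln 1))"
    by (rule D_scale) (use assms T in \<open>auto simp: nrm_pos pos_pt_S T_eq less_imp_neq[THEN not_sym]\<close>)
  then have "D (T x) x + ?n = D (S x) x" by simp
  ultimately show ?thesis by linarith
qed

lemma lower_quotient_increasing:
  assumes "pos_pt x" "normalized x"
  shows "D (T x) (S (T x)) \<le> D x (S x)"
proof -
  have T: "pos_pt (T x)" "normalized (T x)" using pos_pt_T normalized_T assms by auto
  let ?n = "\<Sum>l\<in>K. b l * ln (nrm l x)"
  have "D (T x) (S (T x)) = D (S x) (S (T x)) + (\<Sum>l\<in>K. b l * (ln (1 / nrm l x) - ln 1))"
    by (rule D_scale) (use assms T in \<open>auto simp: nrm_pos pos_pt_S T_eq\<close>)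
  moreover have "(\<Sum>l\<in>K. b l * (ln (1 / nrm l x) - ln 1)) = - ?n"
    unfolding sum_negf[symmetric] using assms nrm_pos by (intro sum.cong refl) (simp add: ln_div)
  moreover have "D (S x) (S (T x)) \<le> D x (T x)"
    using D_S_le[OF assms(1) T(1)] kappa_sum_le_D[OF assms(1) T(1) assms(2) T(2)] by linarith
  moreover have "D x (S x) = D x (T x) + (\<Sum>l\<in>K. b l * (ln 1 - ln (nrm l x)))"
    by (rule D_scale) (use assms T in \<open>auto simp: nrm_pos pos_pt_S T_eq less_imp_neq[THEN not_sym]\<close>)
  then have "D x (T x) + - ?n = D x (S x)" by (simp add: sum_negf)
  ultimately show ?thesis by linarith
qed

section \<open>The Lyapunov function V and its equality case\<close>

definition "V x = D x xt + D xt x"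

lemma V_T:
  assumes "pos_pt x"
  shows "V (T x) = D (S x) (S xt) + D (S xt) (S x)"
proof -
  have "V (T x) = D (T x) (T xt) + D (T xt) (T x)"
    unfolding V_def by (intro arg_cong2[where f="(+)"] D_cong) (auto simp: T_xt)
  also have "\<dots> = D (S x) (S xt) + D (S xt) (S x)"
    unfolding D_T[OF assms pos_pt_xt] D_T[OF pos_pt_xt assms]
    by (simp add: right_diff_distrib sum_subtractf)
  finally show ?thesis .
qed

text \<open>The estimate through \<open>\<kappa>\<close> holds in each of the two orders of
  \<open>x\<close> and \<open>xt\<close>. Equality of the sums therefore forces equality in each of
  them, and then in each summand over \<open>l\<close>.\<close>

lemma
  assumes x: "pos_pt x" "normalized x"
  shows V_T_le: "V (T x) \<le> V x"
    and V_T_eq: "V (T x) = V x \<Longrightarrow> l \<in> K \<Longrightarrow>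
      mx l (S x) (S xt) = ((\<Prod>k\<in>K. mx k x xt) powr q / mx l x xt) powr (1 / b l)"
proof -
  note 1 = D_S_le[OF x(1) pos_pt_xt] D_S_le[OF pos_pt_xt x(1)]
    kappa_sum_le_D[OF x(1) pos_pt_xt x(2) normalized_xt] kappa_sum_le_D[OF pos_pt_xt x(1) normalized_xt x(2)]
  show "V (T x) \<le> V x" using 1 unfolding V_T[OF x(1)] V_def[of x] by linarith
  assume "V (T x) = V x" and l: "l \<in> K"
  then have "D (S x) (S xt) = \<kappa> * (\<Sum>k\<in>K. ln (mx k x xt))"
    using 1 unfolding V_T[OF x(1)] V_def[of x] by linarith
  then have "(\<Sum>l\<in>K. b l * ln (mx l (S x) (S xt))) = (\<Sum>l\<in>K. q * (\<Sum>k\<in>K. ln (mx k x xt)) - ln (mx l x xt))"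
    unfolding D_def sum_ln_mx .
  from sum_eq_imp_eq[OF _ _ this l]
  have "b l * ln (mx l (S x) (S xt)) = q * (\<Sum>k\<in>K. ln (mx k x xt)) - ln (mx l x xt)"
    using ln_mx_S(1)[OF x(1) pos_pt_xt] by auto
  then show "mx l (S x) (S xt) = ((\<Prod>k\<in>K. mx k x xt) powr q / mx l x xt) powr (1 / b l)"
    using ln_mx_S(2)[OF x(1) pos_pt_xt l] by simp
qed

definition "U = Sigma K (\<lambda>l. {..<d l})"

lemma finite_U: "finite U"
  by (simp add: U_def)

lemma U_iff: "(l, j) \<in> U \<longleftrightarrow> l \<in> K \<and> j < d l"
  by (auto simp: U_def)

definition "argmax x = {(l, j) \<in> U. x l j = mx l x xt * xt l j}"

text \<open>Normalisation keeps the maximising coordinates, so a maximiser of \<open>T x\<close>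
  attains the bound on \<open>S x\<close> given by \<open>V_T_eq\<close>. Then
  \<open>S_compare_eq\<close> carries maximality one step back in time, to \<open>x\<close>.\<close>

lemma argmax_T:
  assumes x: "pos_pt x" "normalized x" and V: "V (T x) = V x"
    and J: "J \<in> tidx m d" "0 < f J" "(l, J l) \<in> argmax (T x)"
    and J': "J' \<in> tidx m d" "0 < f J'" "J' i = J i" and k: "k \<in> K"
  shows "(k, J' k) \<in> argmax x"
proof -
  have l: "l \<in> K" and jl: "J l < d l" and eq: "T x l (J l) = mx l (T x) xt * xt l (J l)"
    using J by (auto simp: argmax_def U_iff)
  have "mx l (T x) xt = mx l (T x) (T xt)" using T_xt[OF l] by (intro mx_cong) auto
  also have "\<dots> = (1 / nrm l x) / (1 / nrm l xt) * mx l (S x) (S xt)"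
    by (rule mx_scale) (use x l nrm_pos pos_pt_xt in \<open>auto simp: T_eq\<close>)
  finally have "T x l (J l) = nrm l xt / nrm l x * mx l (S x) (S xt) * T xt l (J l)"
    using eq T_xt[OF l jl] by simp
  then have "S x l (J l) = mx l (S x) (S xt) * S xt l (J l)"
    using nrm_pos[OF x(1) l] nrm_pos[OF pos_pt_xt l] unfolding T_eq[OF l jl] by (simp add: field_simps)
  then have "S x l (J l) = ((\<Prod>k\<in>K. mx k x xt) powr q / mx l x xt) powr (1 / b l) * S xt l (J l)"
    unfolding V_T_eq[OF x V l] .
  from S_compare_eq[OF x(1) pos_pt_xt _ _ l J(1,2) J' k this]
  have "x k (J' k) = mx k x xt * xt k (J' k)"
    using mx_pos[OF x(1) pos_pt_xt] le_mx[OF pos_pt_xt] by auto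
  then show ?thesis using k J' by (auto simp: argmax_def U_iff tidx_less)
qed

lemma argmax_nonempty:
  assumes "l \<in> K"
  shows "\<exists>j. (l, j) \<in> argmax x"
proof -
  obtain j where j: "j < d l" "x l j / xt l j = mx l x xt" using mx_attained[OF assms] by blast
  moreover have "0 < xt l j" using xt_pos assms j by auto
  ultimately have "(l, j) \<in> argmax x" using assms by (auto simp: argmax_def U_iff divide_eq_eq)
  then show ?thesis by blast
qed

text \<open>On a full orbit along which \<open>V\<close> is constant the sets of maximising coordinates decrease, so they
  are eventually constant, and a constant one is closed under adjacency.\<close>

lemma V_constant_imp_zero:
  assumes Y: "pos_pt y" "normalized y" and V: "\<And>n. V ((T ^^ n) y) = v"
  shows "v = 0"
proof -
  define Y where "Y n = (T ^^ n) y" for n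
  have pos: "pos_pt (Y n)" and nor: "normalized (Y n)" for n
  proof -
    show "pos_pt (Y n)" by (induction n) (auto simp: Y_def assms intro: pos_pt_T)
    show "normalized (Y n)"
    proof (cases n)
      case (Suc k)
      have "pos_pt (Y k)" by (induction k) (auto simp: Y_def assms intro: pos_pt_T)
      then show ?thesis using normalized_T Suc by (simp add: Y_def)
    qed (simp add: Y_def assms)
  qed
  have Vn: "V (T (Y n)) = V (Y n)" for n
    using V[of n] V[of "Suc n"] by (simp add: Y_def)
  have Tn: "T (Y n) = Y (Suc n)" for n by (simp add: Y_def)
  \<comment> \<open>With the least cardinality taken at \<open>n\<close>, the inclusion
    \<open>sub\<close> has to be an equality.\<close>
  obtain n where n: "\<And>k. card (argmax (Y n)) \<le> card (argmax (Y k))"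
    using ex_has_least_nat[of "\<lambda>_. True" 0 "\<lambda>n. card (argmax (Y n))"] by auto
  have fin: "finite (argmax x)" for x
    by (rule finite_subset[OF _ finite_U]) (auto simp: argmax_def)
  note step = argmax_T[OF pos[of n] nor[of n] Vn[of n], unfolded Tn]
  have sub: "argmax (Y (Suc n)) \<subseteq> argmax (Y n)"
  proof
    fix a assume a: "a \<in> argmax (Y (Suc n))"
    obtain l j where lj: "a = (l, j)" "l \<in> K" "j < d l" using a by (auto simp: argmax_def U_def)
    obtain J where J: "J \<in> tidx m d" "0 < f J" "J l = j" using vertex_covered[of l j] lj by auto
    show "a \<in> argmax (Y n)" using step[OF J(1,2) _ J(1,2) refl lj(2)] J a lj by auto
  qed
  have E: "argmax (Y (Suc n)) = argmax (Y n)"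
    by (rule card_seteq[OF fin sub n])
  obtain l0 where l0: "l0 \<in> K" using K_nonempty by blast
  obtain j0 where j0: "(l0, j0) \<in> argmax (Y n)" using argmax_nonempty[OF l0] by blast
  have all: "(l, j) \<in> argmax (Y n)" if "l \<in> K" "j < d l" for l j
  proof (rule connected_through_mode[where P = "\<lambda>l j. (l, j) \<in> argmax (Y n)" and i = i])
    show "(l0, j0) \<in> argmax (Y n)" by (rule j0)
  next
    fix J J' l k assume "J \<in> tidx m d" "0 < f J" "J' \<in> tidx m d" "0 < f J'" "J' i = J i"
      "l < m" "l \<noteq> i" "k < m" "k \<noteq> i" "(l, J l) \<in> argmax (Y n)"
    then show "(k, J' k) \<in> argmax (Y n)" using step[of J l J' k] E by auto
  qed (use that l0 j0 in \<open>auto simp: argmax_def U_iff\<close>)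
  \<comment> \<open>All coordinates being maximal, \<open>Y n\<close> is blockwise proportional to
    \<open>xt\<close>, and the two shifts from \<open>D_scale\<close> cancel in
    \<open>V\<close>.\<close>
  define c where "c l = mx l (Y n) xt" for l
  have c: "0 < c l" if "l \<in> K" for l unfolding c_def using mx_pos pos pos_pt_xt that by auto
  have Yn: "Y n l j = c l * xt l j" if "l \<in> K" "j < d l" for l j
    using all[OF that] by (auto simp: argmax_def c_def)
  have "D (Y n) xt = D xt xt + (\<Sum>l\<in>K. b l * (ln (c l) - ln 1))"
    by (rule D_scale) (use c Yn pos_pt_xt in auto)
  moreover have "D xt (Y n) = D xt xt + (\<Sum>l\<in>K. b l * (ln 1 - ln (c l)))"
    by (rule D_scale) (use c Yn pos_pt_xt in auto)
  ultimately have "V (Y n) = 0" by (simp add: V_def sum_negf D_xt_xt)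
  then show ?thesis using V[of n] by (simp add: Y_def)
qed

text \<open>For normalised points all summands of \<open>D\<close> are nonnegative, so each single
  logarithm is at most \<open>D / b l\<close>. Thus \<open>V\<close> controls every coordinate from
  both sides.\<close>

lemma V_bounds:
  assumes x: "pos_pt x" "normalized x" and l: "l \<in> K" "j < d l"
  shows "x l j \<le> exp (V x / b l) * xt l j" "exp (- V x / b l) * xt l j \<le> x l j"
proof -
  have bnd: "mx l u v \<le> exp (D u v / b l)"
    if "pos_pt u" "pos_pt v" "normalized u" "normalized v" for u v
  proof -
    have "b l * ln (mx l u v) \<le> D u v"
      unfolding D_def using l mx_normalized[OF that] b_pos
      by (intro member_le_sum[of l K "\<lambda>l. b l * ln (mx l u v)"]) (auto intro!: mult_nonneg_nonneg intro: less_imp_le)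
    then have "ln (mx l u v) \<le> D u v / b l" using b_pos[OF l(1)] by (simp add: field_simps)
    then show ?thesis using mx_pos[OF that(1,2) l(1)] by (metis exp_le_cancel_iff exp_ln)
  qed
  have n: "0 \<le> D x xt" "0 \<le> D xt x"
    using D_nonneg x pos_pt_xt normalized_xt by auto
  have b: "0 < b l" and xl: "0 < xt l j" "0 < x l j"
    using b_pos xt_pos l x by (auto simp: pos_pt_def)
  have "x l j \<le> mx l x xt * xt l j" using le_mx pos_pt_xt l by auto
  also have "mx l x xt \<le> exp (D x xt / b l)" using bnd x pos_pt_xt normalized_xt by auto
  also have "exp (D x xt / b l) \<le> exp (V x / b l)" using n b by (auto simp: V_def divide_right_mono)
  finally show "x l j \<le> exp (V x / b l) * xt l j" using xl by simp
  have "xt l j \<le> mx l xt x * x l j" using le_mx x l by auto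
  also have "mx l xt x \<le> exp (D xt x / b l)" using bnd x pos_pt_xt normalized_xt by auto
  also have "exp (D xt x / b l) \<le> exp (V x / b l)" using n b by (auto simp: V_def divide_right_mono)
  finally have "xt l j \<le> exp (V x / b l) * x l j" using xl by simp
  then show "exp (- V x / b l) * xt l j \<le> x l j" by (simp add: exp_minus field_simps)
qed

section \<open>Continuity in the relevant coordinates\<close>

definition conv_to :: "(nat \<Rightarrow> nat \<Rightarrow> nat \<Rightarrow> real) \<Rightarrow> (nat \<Rightarrow> nat \<Rightarrow> real) \<Rightarrow> bool" where
  "conv_to X y \<longleftrightarrow> (\<forall>l\<in>K. \<forall>j<d l. (\<lambda>n. X n l j) \<longlonglongrightarrow> y l j)"

lemma conv_to_S:
  assumes X: "conv_to X y" "\<And>n. pos_pt (X n)" and y: "pos_pt y"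
  shows "conv_to (\<lambda>n. S (X n)) (S y)"
proof -
  have "(\<lambda>n. S (X n) l j) \<longlonglongrightarrow> S y l j" if l: "l \<in> K" "j < d l" for l j
  proof -
    have i: "(\<lambda>n. grad m d f i (X n) t) \<longlonglongrightarrow> grad m d f i y t" for t
      unfolding grad_def using X
      by (intro tendsto_sum tendsto_mult tendsto_prod tendsto_const) (auto simp: conv_to_def tidx_less)
    have e: "(\<lambda>n. ext (X n) k t) \<longlonglongrightarrow> ext y k t" if "k < m" "t < d k" for k t
    proof (cases "k = i")
      case True
      then show ?thesis using that X(2) y grad_i_pos[OF y, of t] i[of t]
        by (auto simp: ext_i intro!: tendsto_powr)
    next
      case False
      then show ?thesis using X that by (simp add: ext_other conv_to_def)
    qed
    have "(\<lambda>n. grad m d f l (ext (X n)) j) \<longlonglongrightarrow> grad m d f l (ext y) j"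
      unfolding grad_def
      by (intro tendsto_sum tendsto_mult tendsto_prod tendsto_const) (auto simp: e tidx_less)
    then show ?thesis unfolding S_eq[OF y l] S_eq[OF X(2) l]
      using grad_ext_pos[OF y l] by (intro tendsto_powr) auto
  qed
  then show ?thesis by (simp add: conv_to_def)
qed

lemma tendsto_pnorm:
  assumes "\<And>j. j < n \<Longrightarrow> ((\<lambda>k. v k j) \<longlongrightarrow> w j) F" "0 < n" "\<And>j. j < n \<Longrightarrow> 0 < w j"
  shows "((\<lambda>k. pnorm r n (v k)) \<longlongrightarrow> pnorm r n w) F"
proof -
  have "0 < (\<Sum>j<n. \<bar>w j\<bar> powr r)"
    by (rule sum_pos) (use assms(2,3) in fastforce)+
  moreover have "w j \<noteq> 0" if "j < n" for j using assms(3)[OF that] by simp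
  ultimately show ?thesis unfolding pnorm_def
    by (intro tendsto_powr tendsto_sum tendsto_const tendsto_rabs assms(1)) auto
qed

lemma conv_to_T:
  assumes X: "conv_to X y" "\<And>n. pos_pt (X n)" and y: "pos_pt y"
  shows "conv_to (\<lambda>n. T (X n)) (T y)"
proof -
  note S = conv_to_S[OF assms]
  have "(\<lambda>n. T (X n) l j) \<longlonglongrightarrow> T y l j" if l: "l \<in> K" "j < d l" for l j
  proof -
    have "(\<lambda>n. nrm l (X n)) \<longlonglongrightarrow> nrm l y"
      unfolding nrm_def using S l d_pos'[of l] S_pos[OF y]
      by (intro tendsto_pnorm) (auto simp: conv_to_def)
    then show ?thesis unfolding T_eq[OF l] using S l nrm_pos[OF y l(1)]
      by (intro tendsto_divide) (auto simp: conv_to_def)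
  qed
  then show ?thesis by (simp add: conv_to_def)
qed

lemma tendsto_D:
  assumes X: "conv_to X x" "conv_to Y y" and x: "pos_pt x" and y: "pos_pt y"
  shows "(\<lambda>n. D (X n) (Y n)) \<longlonglongrightarrow> D x y"
proof -
  have "(\<lambda>n. mx l (X n) (Y n)) \<longlonglongrightarrow> mx l x y" if l: "l \<in> K" for l
    unfolding mx_def
  proof (rule tendsto_Max_image)
    fix j assume "j \<in> {..<d l}"
    then show "(\<lambda>n. X n l j / Y n l j) \<longlonglongrightarrow> x l j / y l j"
      using l X y by (intro tendsto_divide) (force simp: conv_to_def pos_pt_def)+
  qed (use d_pos'[OF l] in auto)
  then show ?thesis unfolding D_def using mx_pos[OF x y]
    by (intro tendsto_sum tendsto_mult tendsto_const tendsto_ln) (metis less_irrefl)+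
qed

section \<open>Convergence of the iterates\<close>

context
  fixes x0
  assumes x0: "pos_pt x0" "normalized x0"
begin

definition "xs n = (T ^^ n) x0"

lemma xs_Suc: "xs (Suc n) = T (xs n)"
  by (simp add: xs_def)

lemma xs_pos: "pos_pt (xs n)"
  by (induction n) (auto simp: xs_def x0 intro: pos_pt_T)

lemma xs_normalized: "normalized (xs n)"
  using x0 by (cases n) (simp_all add: xs_Suc xs_pos normalized_T, simp add: xs_def)

lemma V_xs_nonneg: "0 \<le> V (xs n)"
  unfolding V_def using D_nonneg xs_pos xs_normalized pos_pt_xt normalized_xt by (intro add_nonneg_nonneg) auto

lemma V_xs_decseq: "decseq (\<lambda>n. V (xs n))"
  by (rule decseq_SucI) (simp add: xs_Suc V_T_le xs_pos xs_normalized)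

text \<open>Invariance principle: the values of \<open>V\<close> decrease to some \<open>v\<close>,
  the iterates have a limit point \<open>y\<close>, and by continuity \<open>V\<close> equals
  \<open>v\<close> on the whole orbit of \<open>y\<close>, which forces
  \<open>v = 0\<close>.\<close>

lemma V_xs_tendsto: "(\<lambda>n. V (xs n)) \<longlonglongrightarrow> 0"
proof -
  obtain v where v: "(\<lambda>n. V (xs n)) \<longlonglongrightarrow> v"
    using decseq_convergent[OF V_xs_decseq, of 0] V_xs_nonneg by blast
  have V0: "V (xs n) \<le> V x0" for n
    using decseqD[OF V_xs_decseq, of 0 n] by (simp add: xs_def)
  \<comment> \<open>The upper bound gives compactness, the lower bound keeps the limit point
    strictly positive.\<close>
  have lo: "exp (- V x0 / b l) * xt l j \<le> xs n l j" and hi: "xs n l j \<le> exp (V x0 / b l) * xt l j"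
    if "l \<in> K" "j < d l" for n l j
  proof -
    have b: "0 < b l" "0 < xt l j" using b_pos xt_pos that by auto
    have "exp (- V x0 / b l) * xt l j \<le> exp (- V (xs n) / b l) * xt l j"
      "exp (V (xs n) / b l) * xt l j \<le> exp (V x0 / b l) * xt l j"
      using b V0[of n] by (auto simp: divide_right_mono)
    then show "exp (- V x0 / b l) * xt l j \<le> xs n l j" "xs n l j \<le> exp (V x0 / b l) * xt l j"
      using V_bounds[OF xs_pos xs_normalized that, of n] by linarith+
  qed
  have "\<bar>case_prod (xs n) a\<bar> \<le> (case a of (l, j) \<Rightarrow> exp (V x0 / b l) * xt l j)" if "a \<in> U" for n a
  proof -
    obtain l j where a: "a = (l, j)" "l \<in> K" "j < d l" using \<open>a \<in> U\<close> by (auto simp: U_def)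
    then have "0 < xs n l j" using xs_pos[of n] by (simp add: pos_pt_def)
    then show ?thesis using hi[OF a(2,3), of n] a(1) by simp
  qed
  from finite_coordinates_subseq[where X = "\<lambda>n. case_prod (xs n)", OF finite_U this] obtain r L where
    r: "strict_mono (r :: nat \<Rightarrow> nat)" and L: "\<forall>a\<in>U. (\<lambda>n. case_prod (xs (r n)) a) \<longlonglongrightarrow> L a" by blast
  define y where "y l j = L (l, j)" for l j
  have conv: "conv_to (\<lambda>k. xs (r k)) y"
    unfolding conv_to_def y_def using L by (auto simp: U_def)
  have y: "pos_pt y"
    unfolding pos_pt_def
  proof (intro ballI allI impI)
    fix l j assume l: "l \<in> K" "j < d l"
    have "exp (- V x0 / b l) * xt l j \<le> y l j"
      using conv l lo by (intro LIMSEQ_le_const[of "\<lambda>k. xs (r k) l j"]) (auto simp: conv_to_def)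
    moreover have "0 < exp (- V x0 / b l) * xt l j" using xt_pos l by auto
    ultimately show "0 < y l j" by linarith
  qed
  have yn: "normalized y"
    unfolding normalized_def
  proof
    fix l assume l: "l \<in> K"
    have "(\<lambda>k. pnorm (p l) (d l) (xs (r k) l)) \<longlonglongrightarrow> pnorm (p l) (d l) (y l)"
      using conv l y d_pos'[OF l] by (intro tendsto_pnorm) (auto simp: conv_to_def pos_pt_def)
    moreover have "pnorm (p l) (d l) (xs (r k) l) = 1" for k
      using xs_normalized l by (simp add: normalized_def)
    ultimately show "pnorm (p l) (d l) (y l) = 1" by (simp add: LIMSEQ_const_iff)
  qed
  have Ypos: "pos_pt ((T ^^ n) y)" for n
    by (induction n) (auto simp: y intro: pos_pt_T)
  have convn: "conv_to (\<lambda>k. xs (r k + n)) ((T ^^ n) y)" for n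
  proof (induction n)
    case 0
    then show ?case using conv by simp
  next
    case (Suc n)
    from conv_to_T[OF Suc xs_pos Ypos] show ?case by (simp add: xs_Suc)
  qed
  \<comment> \<open>Moving \<open>n\<close> steps past the subsequence leads to
    \<open>(T ^^ n) y\<close>, while \<open>V\<close> still tends to its limit along the whole
    sequence.\<close>
  have "V ((T ^^ n) y) = v" for n
  proof (rule LIMSEQ_unique)
    have c: "conv_to (\<lambda>k. xt) xt" by (simp add: conv_to_def)
    show "(\<lambda>k. V (xs (r k + n))) \<longlonglongrightarrow> V ((T ^^ n) y)"
      unfolding V_def by (intro tendsto_add tendsto_D convn c Ypos pos_pt_xt)
    have "filterlim (\<lambda>k. r k + n) sequentially sequentially"
      by (rule filterlim_at_top_mono[OF filterlim_subseq[OF r]]) auto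
    from filterlim_compose[OF v this] show "(\<lambda>k. V (xs (r k + n))) \<longlonglongrightarrow> v" .
  qed
  from V_constant_imp_zero[OF y yn this] have "v = 0" .
  then show ?thesis using v by simp
qed

lemma xs_conv: "conv_to xs xt"
  unfolding conv_to_def
proof (intro ballI allI impI)
  fix l j assume l: "l \<in> K" "j < d l"
  have e: "(\<lambda>n. exp (- V (xs n) / b l) * xt l j) \<longlonglongrightarrow> exp (- 0 / b l) * xt l j"
    "(\<lambda>n. exp (V (xs n) / b l) * xt l j) \<longlonglongrightarrow> exp (0 / b l) * xt l j"
    using b_pos[OF l(1)] by (intro tendsto_intros V_xs_tendsto; simp)+
  show "(\<lambda>n. xs n l j) \<longlonglongrightarrow> xt l j"
    by (rule tendsto_sandwich[of "\<lambda>n. exp (- V (xs n) / b l) * xt l j" _ _ "\<lambda>n. exp (V (xs n) / b l) * xt l j"])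
      (use e V_bounds[OF xs_pos xs_normalized l] in auto)
qed

end

end

section \<open>First-order expansions along a sequence\<close>

text \<open>A derivative along a single sequence instead of in a neighbourhood: \<open>a\<close> is
  1 plus a linear term of order \<open>e\<close>, up to \<open>o(e)\<close>. Later \<open>a\<close>
  is a ratio to the fixed point and \<open>e\<close> the size of the error itself.\<close>

definition expands :: "(nat \<Rightarrow> real) \<Rightarrow> (nat \<Rightarrow> real) \<Rightarrow> (nat \<Rightarrow> real) \<Rightarrow> bool" where
  "expands e a \<alpha> \<longleftrightarrow> (\<lambda>n. a n - 1 - \<alpha> n) \<in> o(e) \<and> \<alpha> \<in> O(e)"

lemma expands_bigo: "expands e a \<alpha> \<Longrightarrow> (\<lambda>n. a n - 1) \<in> O(e)"
proof -
  assume *: "expands e a \<alpha>"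
  have "(\<lambda>n. (a n - 1 - \<alpha> n) + \<alpha> n) \<in> O(e)"
    using * unfolding expands_def by (intro sum_in_bigo(1)) (auto intro: landau_o.small_imp_big)
  then show ?thesis by simp
qed

lemma bigo_null_smallo_1:
  fixes e g :: "nat \<Rightarrow> real"
  assumes "e \<longlonglongrightarrow> 0" "g \<in> O(e)"
  shows "g \<in> o(\<lambda>_. 1)"
proof -
  have "e \<in> o(\<lambda>_. 1)" using assms(1) by (intro smalloI_tendsto) auto
  then show ?thesis using assms(2) landau_o.big_small_trans by blast
qed

lemma expands_tendsto:
  assumes "e \<longlonglongrightarrow> 0" "expands e a \<alpha>"
  shows "a \<longlonglongrightarrow> 1"
proof -
  have "(\<lambda>n. a n - 1) \<in> o(\<lambda>_. 1)" using bigo_null_smallo_1 assms expands_bigo by blast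
  then have "(\<lambda>n. a n - 1) \<longlonglongrightarrow> 0" using smalloD_tendsto by fastforce
  then show ?thesis using LIM_zero_cancel by blast
qed

lemma smallo_1_mult_bigo:
  fixes g h e :: "nat \<Rightarrow> real"
  assumes "g \<in> o(\<lambda>_. 1)" "h \<in> O(e)"
  shows "(\<lambda>n. g n * h n) \<in> o(e)"
  using landau_o.small_big_mult[OF assms] by simp

lemma expands_mult:
  assumes e: "e \<longlonglongrightarrow> 0" and a: "expands e a \<alpha>" and b: "expands e b \<beta>"
  shows "expands e (\<lambda>n. a n * b n) (\<lambda>n. \<alpha> n + \<beta> n)"
proof -
  \<comment> \<open>The cross term is a null sequence times \<open>O(e)\<close>.\<close>
  have "(\<lambda>n. (a n - 1) * (b n - 1) + ((a n - 1 - \<alpha> n) + (b n - 1 - \<beta> n))) \<in> o(e)"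
    using a b smallo_1_mult_bigo[OF bigo_null_smallo_1[OF e expands_bigo[OF a]] expands_bigo[OF b]]
    unfolding expands_def by (intro sum_in_smallo(1)) auto
  moreover have "(\<lambda>n. (a n - 1) * (b n - 1) + ((a n - 1 - \<alpha> n) + (b n - 1 - \<beta> n)))
      = (\<lambda>n. a n * b n - 1 - (\<alpha> n + \<beta> n))" by (simp add: fun_eq_iff algebra_simps)
  ultimately show ?thesis using a b unfolding expands_def by (auto intro: sum_in_bigo)
qed

lemma expands_1: "expands e (\<lambda>_. 1) (\<lambda>_. 0)"
  by (simp add: expands_def)

lemma expands_prod:
  assumes e: "e \<longlonglongrightarrow> 0" and "finite A" "\<And>k. k \<in> A \<Longrightarrow> expands e (a k) (\<alpha> k)"
  shows "expands e (\<lambda>n. \<Prod>k\<in>A. a k n) (\<lambda>n. \<Sum>k\<in>A. \<alpha> k n)"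
  using assms(2,3)
  by (induction A rule: finite_induct) (simp_all add: expands_1 expands_mult[OF e])

text \<open>The constant parts recombine to 1 because the coefficients sum to 1. Conditional
  expectations and power means are expanded through this rule.\<close>

lemma expands_convex:
  assumes "finite A" "\<And>k. k \<in> A \<Longrightarrow> expands e (a k) (\<alpha> k)" "(\<Sum>k\<in>A. c k) = 1"
  shows "expands e (\<lambda>n. \<Sum>k\<in>A. c k * a k n) (\<lambda>n. \<Sum>k\<in>A. c k * \<alpha> k n)"
proof -
  have "(\<lambda>n. \<Sum>k\<in>A. c k * (a k n - 1 - \<alpha> k n)) \<in> o(e)"
    using assms(2) by (intro big_sum_in_smallo) (auto simp: expands_def)
  moreover have "(\<lambda>n. \<Sum>k\<in>A. c k * (a k n - 1 - \<alpha> k n)) =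
      (\<lambda>n. (\<Sum>k\<in>A. c k * a k n) - 1 - (\<Sum>k\<in>A. c k * \<alpha> k n))"
    using assms(3) by (simp add: right_diff_distrib sum_subtractf)
  moreover have "(\<lambda>n. \<Sum>k\<in>A. c k * \<alpha> k n) \<in> O(e)"
    using assms(2) by (intro big_sum_in_bigo) (auto simp: expands_def)
  ultimately show ?thesis by (simp add: expands_def)
qed

text \<open>Caratheodory's form of differentiability supplies a difference quotient \<open>h\<close>
  continuous at 1, so \<open>h (a n) - D\<close> is a null sequence and its product with
  \<open>a n - 1\<close> is \<open>o(e)\<close>.\<close>

lemma expands_deriv:
  assumes e: "e \<longlonglongrightarrow> 0" and a: "expands e a \<alpha>"
    and g: "(g has_real_derivative D) (at 1)" "g 1 = 1"
  shows "expands e (\<lambda>n. g (a n)) (\<lambda>n. D * \<alpha> n)"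
proof -
  obtain h where h: "\<And>z. g z - g 1 = h z * (z - 1)" "isCont h 1" "h 1 = D"
    using g(1) unfolding CARAT_DERIV by blast
  have "(\<lambda>n. h (a n)) \<longlonglongrightarrow> D"
    using isCont_tendsto_compose[OF h(2) expands_tendsto[OF e a]] h(3) by simp
  then have "(\<lambda>n. h (a n) - D) \<in> o(\<lambda>_. 1)"
    by (intro smalloI_tendsto) (auto intro: LIM_zero)
  from smallo_1_mult_bigo[OF this expands_bigo[OF a]]
  have "(\<lambda>n. (h (a n) - D) * (a n - 1) + D * (a n - 1 - \<alpha> n)) \<in> o(e)"
    using a by (intro sum_in_smallo(1)) (auto simp: expands_def)
  moreover have "(h (a n) - D) * (a n - 1) + D * (a n - 1 - \<alpha> n) = g (a n) - 1 - D * \<alpha> n" for n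
    using h(1)[of "a n"] g(2) by (simp add: algebra_simps)
  ultimately show ?thesis using a by (simp add: expands_def)
qed

lemma expands_powr:
  assumes "e \<longlonglongrightarrow> 0" "expands e a \<alpha>"
  shows "expands e (\<lambda>n. a n powr s) (\<lambda>n. s * \<alpha> n)"
  by (rule expands_deriv[OF assms]) (auto intro!: derivative_eq_intros)

lemma expands_divide:
  assumes e: "e \<longlonglongrightarrow> 0" and a: "expands e a \<alpha>" and b: "expands e b \<beta>"
  shows "expands e (\<lambda>n. a n / b n) (\<lambda>n. \<alpha> n - \<beta> n)"
proof -
  have "expands e (\<lambda>n. inverse (b n)) (\<lambda>n. (- 1) * \<beta> n)"
    by (rule expands_deriv[OF e b]) (auto intro!: derivative_eq_intros)
  from expands_mult[OF e a this] show ?thesis by (simp add: divide_inverse)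
qed

section \<open>The linearised iteration\<close>

context hgpm_setting
begin

text \<open>At the singular vector the weights \<open>f J * (\<Prod>k<m. xt k (J k)) / lam\<close> form a probability
  distribution on multi-indices whose marginals are \<open>\<omega> k\<close>; \<open>CE k t\<close> is the conditional expectation
  given \<open>J k = t\<close>.\<close>

definition "wt J = f J * (\<Prod>k<m. xt k (J k)) / lam"
definition "\<omega> k t = xt k t powr p k"
definition "CE k t \<phi> = (\<Sum>J\<in>{J \<in> tidx m d. J k = t}. wt J * \<phi> J) / \<omega> k t" for \<phi> :: "(nat \<Rightarrow> nat) \<Rightarrow> real"

lemma omega_pos: "k < m \<Longrightarrow> t < d k \<Longrightarrow> 0 < \<omega> k t"
  using xt_pos[of k t] by (simp add: \<omega>_def)

lemma wt_nonneg: "J \<in> tidx m d \<Longrightarrow> 0 \<le> wt J"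
  unfolding wt_def using lam_pos f_nonneg xt_pos
  by (intro divide_nonneg_pos mult_nonneg_nonneg prod_nonneg) (auto simp: tidx_less intro: less_imp_le)

lemma wt_pos: "J \<in> tidx m d \<Longrightarrow> 0 < f J \<Longrightarrow> 0 < wt J"
  unfolding wt_def using lam_pos xt_pos
  by (intro divide_pos_pos mult_pos_pos prod_pos) (auto simp: tidx_less)

lemma wt_remove:
  assumes "k < m"
  shows "wt J = xt k (J k) / lam * (f J * (\<Prod>l\<in>{..<m} - {k}. xt l (J l)))"
  unfolding wt_def using assms by (subst prod.remove[of _ k]) auto

lemma omega_eq:
  assumes "k < m" "t < d k"
  shows "\<omega> k t = xt k t / lam * grad m d f k xt t"
  using assms xt_pos[OF assms] lam_pos by (simp add: eigen \<omega>_def powr_diff)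

text \<open>This is the eigenvalue equation multiplied by \<open>xt k t / lam\<close>.\<close>

lemma sum_wt_marginal:
  assumes "k < m" "t < d k"
  shows "(\<Sum>J\<in>{J \<in> tidx m d. J k = t}. wt J) = \<omega> k t"
  unfolding omega_eq[OF assms] grad_def sum_distrib_left
  using wt_remove[OF assms(1)] by (intro sum.cong) auto

lemma CE_const: "k < m \<Longrightarrow> t < d k \<Longrightarrow> CE k t (\<lambda>_. c) = c"
  using omega_pos[of k t] by (simp add: CE_def sum_wt_marginal flip: sum_distrib_right)

lemma CE_lin: "CE k t (\<lambda>J. \<phi> J + a * \<psi> J) = CE k t \<phi> + a * CE k t \<psi>"
  by (simp add: CE_def sum.distrib sum_distrib_left add_divide_distrib algebra_simps)

lemma CE_cong: "(\<And>J. J \<in> tidx m d \<Longrightarrow> J k = t \<Longrightarrow> \<phi> J = \<psi> J) \<Longrightarrow> CE k t \<phi> = CE k t \<psi>"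
  unfolding CE_def by (intro arg_cong2[where f="(/)"] sum.cong) auto

lemma CE_nonneg:
  assumes "k < m" "t < d k" "\<And>J. J \<in> tidx m d \<Longrightarrow> 0 \<le> \<phi> J"
  shows "0 \<le> CE k t \<phi>"
  unfolding CE_def using assms omega_pos wt_nonneg
  by (intro divide_nonneg_pos sum_nonneg mult_nonneg_nonneg) auto

lemma CE_eq_0:
  assumes "k < m" "\<And>J. J \<in> tidx m d \<Longrightarrow> 0 \<le> \<phi> J" and J: "J \<in> tidx m d" "0 < f J"
    and "CE k (J k) \<phi> = 0"
  shows "\<phi> J = 0"
proof -
  have "0 < \<omega> k (J k)" using omega_pos assms tidx_less by auto
  then have "(\<Sum>J\<in>{J' \<in> tidx m d. J' k = J k}. wt J * \<phi> J) = 0"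
    using assms(5) by (simp add: CE_def)
  then have "wt J * \<phi> J = 0"
    by (subst (asm) sum_nonneg_eq_0_iff) (use assms(2) J in \<open>auto simp: tidx_finite wt_nonneg\<close>)
  then show ?thesis using wt_pos[OF J] by simp
qed

lemma sum_fibres:
  assumes "k < m"
  shows "(\<Sum>t<d k. \<Sum>J\<in>{J \<in> tidx m d. J k = t}. g J) = (\<Sum>J\<in>tidx m d. g J)"
  by (rule sum.group) (use assms in \<open>auto simp: tidx_finite tidx_less\<close>)

lemma sum_CE:
  assumes "k < m"
  shows "(\<Sum>t<d k. \<omega> k t * CE k t \<phi>) = (\<Sum>J\<in>tidx m d. wt J * \<phi> J)"
proof -
  have "(\<Sum>t<d k. \<omega> k t * CE k t \<phi>) = (\<Sum>t<d k. \<Sum>J\<in>{J \<in> tidx m d. J k = t}. wt J * \<phi> J)"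
    using omega_pos[OF assms] by (intro sum.cong refl) (auto simp: CE_def less_imp_neq[THEN not_sym])
  then show ?thesis using sum_fibres[OF assms] by simp
qed

lemma sum_wt_coordinate:
  assumes "k < m"
  shows "(\<Sum>J\<in>tidx m d. wt J * h (J k)) = (\<Sum>t<d k. \<omega> k t * h t)"
proof -
  have "(\<Sum>J\<in>tidx m d. wt J * h (J k)) = (\<Sum>t<d k. \<Sum>J\<in>{J \<in> tidx m d. J k = t}. wt J * h (J k))"
    by (rule sum_fibres[OF assms, symmetric])
  also have "\<dots> = (\<Sum>t<d k. (\<Sum>J\<in>{J \<in> tidx m d. J k = t}. wt J) * h t)"
    unfolding sum_distrib_right by (intro sum.cong) auto
  also have "\<dots> = (\<Sum>t<d k. \<omega> k t * h t)"
    using sum_wt_marginal[OF assms] by (intro sum.cong) auto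
  finally show ?thesis .
qed

lemma sum_omega: "k < m \<Longrightarrow> (\<Sum>t<d k. \<omega> k t) = 1"
proof -
  assume k: "k < m"
  have "(\<Sum>j<d k. \<bar>xt k j\<bar> powr p k) = (\<Sum>j<d k. \<omega> k j)"
    using xt_pos[OF k] by (intro sum.cong) (auto simp: \<omega>_def abs_of_pos)
  then have *: "(\<Sum>j<d k. \<omega> k j) powr (1 / p k) = 1" using xt_norm[OF k] by (simp add: pnorm_def)
  have "0 < (\<Sum>j<d k. \<omega> k j)" using omega_pos[OF k] d_pos[OF k] by (intro sum_pos) auto
  then have "((\<Sum>j<d k. \<omega> k j) powr (1 / p k)) powr p k = (\<Sum>j<d k. \<omega> k j)"
    using p_gt1[OF k] by (simp add: powr_powr)
  then show ?thesis using * by simp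
qed

text \<open>The term of \<open>J\<close> in the gradient at \<open>xt\<close> is proportional to
  \<open>wt J\<close>, so passing from \<open>xt\<close> to \<open>X\<close> only inserts the
  ratios. Gradients become averages of products, to which the expansion rules apply.\<close>

lemma grad_ratio:
  assumes "k < m" "t < d k"
  shows "grad m d f k X t = grad m d f k xt t * CE k t (\<lambda>J. \<Prod>l\<in>{..<m} - {k}. X l (J l) / xt l (J l))"
proof -
  have x: "0 < xt k t" and G: "0 < grad m d f k xt t"
    using xt_pos assms by (auto intro: grad_pos)
  have "wt J * (\<Prod>l\<in>{..<m} - {k}. X l (J l) / xt l (J l)) = xt k t / lam * (f J * (\<Prod>l\<in>{..<m} - {k}. X l (J l)))"
    if J: "J \<in> tidx m d" "J k = t" for J
  proof -
    have "(\<Prod>l\<in>{..<m} - {k}. xt l (J l)) * (\<Prod>l\<in>{..<m} - {k}. X l (J l) / xt l (J l)) = (\<Prod>l\<in>{..<m} - {k}. X l (J l))"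
      unfolding prod.distrib[symmetric] using xt_pos J
      by (intro prod.cong) (auto simp: tidx_less less_imp_neq[THEN not_sym])
    then show ?thesis unfolding wt_remove[OF assms(1)] J(2) by (simp add: mult.assoc)
  qed
  then have "CE k t (\<lambda>J. \<Prod>l\<in>{..<m} - {k}. X l (J l) / xt l (J l)) = xt k t / lam * grad m d f k X t / \<omega> k t"
    unfolding CE_def grad_def sum_distrib_left by (intro arg_cong2[where f="(/)"] sum.cong) auto
  then show ?thesis unfolding omega_eq[OF assms] using x G lam_pos by simp
qed

lemma grad_ratio_ext:
  assumes l: "l \<in> K" "j < d l"
  shows "grad m d f l X j = grad m d f l (ext xt) j * CE l j (\<lambda>J. \<Prod>k\<in>{..<m} - {l}. X k (J k) / ext xt k (J k))"
proof -
  let ?c = "lam powr (q - 1)"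
  have c: "?c \<noteq> 0" using lam_pos by simp
  \<comment> \<open>The summand 0 gives the shape of \<open>CE_lin\<close>; the factor
    \<open>?c\<close> is the discrepancy between \<open>ext xt\<close> and \<open>xt\<close> in mode
    \<open>i\<close>.\<close>
  have "CE l j (\<lambda>J. \<Prod>k\<in>{..<m} - {l}. X k (J k) / xt k (J k))
      = CE l j (\<lambda>J. 0 + ?c * (\<Prod>k\<in>{..<m} - {l}. X k (J k) / ext xt k (J k)))"
  proof (rule CE_cong)
    fix J assume J: "J \<in> tidx m d"
    have "{..<m} - {l} - {i} = K - {l}" by auto
    moreover have "i \<in> {..<m} - {l}" using l i_less by auto
    moreover have "(\<Prod>k\<in>K - {l}. X k (J k) / ext xt k (J k)) = (\<Prod>k\<in>K - {l}. X k (J k) / xt k (J k))"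
      by (intro prod.cong) (auto simp: ext_other)
    moreover have "ext xt i (J i) = ?c * xt i (J i)" using J i_less by (simp add: ext_xt_i tidx_less)
    ultimately show "(\<Prod>k\<in>{..<m} - {l}. X k (J k) / xt k (J k)) =
        0 + ?c * (\<Prod>k\<in>{..<m} - {l}. X k (J k) / ext xt k (J k))"
      using c by (simp add: prod.remove[of "{..<m} - {l}" i])
  qed
  then show ?thesis unfolding CE_lin using l grad_ratio[of l j X] by (simp add: grad_ext_xt CE_const)
qed

text \<open>Derivatives in relative coordinates at \<open>xt\<close>: \<open>lin_i\<close> belongs
  to the completed block, \<open>lin\<close> to \<open>S\<close>, and \<open>cen\<close> to the
  normalisation. Products of ratios become sums, and \<open>q - 1\<close> and \<open>1 / b l\<close>
  are the exponents of the powers taken.\<close>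

definition "lin_i w t = (q - 1) * CE i t (\<lambda>J. \<Sum>k\<in>K. w k (J k))"
definition "lin w l j = 1 / b l * CE l j (\<lambda>J. (\<Sum>k\<in>K - {l}. w k (J k)) + lin_i w (J i))"
definition "mean w l = (\<Sum>j<d l. \<omega> l j * w l j)"
definition "cen w l j = w l j - mean w l"

text \<open>\<open>S xt l\<close> is proportional to \<open>xt l\<close>, whose powers of exponent
  \<open>p l\<close> are the weights; hence the ratio of norms is a power mean with total weight
  1.\<close>

lemma nrm_ratio:
  assumes x: "pos_pt x" and l: "l \<in> K"
  shows "nrm l x / nrm l xt = (\<Sum>j<d l. \<omega> l j * (S x l j / S xt l j) powr p l) powr (1 / p l)"
proof -
  let ?c = "lam powr (q / b l)"
  have c: "0 < ?c" using lam_pos by simp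
  have eq: "nrm l y = ?c * (\<Sum>j<d l. \<omega> l j * (S y l j / S xt l j) powr p l) powr (1 / p l)"
    if y: "pos_pt y" for y
  proof -
    have "\<bar>S y l j\<bar> powr p l = ?c powr p l * (\<omega> l j * (S y l j / S xt l j) powr p l)" if "j < d l" for j
    proof -
      have "0 < S y l j" "0 < xt l j" using S_pos[OF y l that] xt_pos l that by auto
      then show ?thesis using c l that by (simp add: S_xt \<omega>_def powr_divide powr_mult)
    qed
    then have "(\<Sum>j<d l. \<bar>S y l j\<bar> powr p l) = ?c powr p l * (\<Sum>j<d l. \<omega> l j * (S y l j / S xt l j) powr p l)"
      unfolding sum_distrib_left by (intro sum.cong) auto
    moreover have "0 \<le> (\<Sum>j<d l. \<omega> l j * (S y l j / S xt l j) powr p l)"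
      using omega_pos[of l] l by (intro sum_nonneg mult_nonneg_nonneg) (auto intro: less_imp_le)
    ultimately show ?thesis
      using c p_gt1[of l] l by (simp add: nrm_def pnorm_def powr_mult powr_powr)
  qed
  have "(\<Sum>j<d l. \<omega> l j * (S xt l j / S xt l j) powr p l) = (\<Sum>j<d l. \<omega> l j)"
    using S_pos[OF pos_pt_xt l] by (intro sum.cong) (auto simp: less_imp_neq[THEN not_sym])
  then have "nrm l xt = ?c" using eq[OF pos_pt_xt] sum_omega[of l] l by simp
  then show ?thesis using eq[OF x] c by simp
qed

lemma expands_CE:
  assumes "k < m" "t < d k" "\<And>J. J \<in> tidx m d \<Longrightarrow> J k = t \<Longrightarrow> expands e (\<lambda>n. a n J) (\<lambda>n. \<alpha> n J)"
  shows "expands e (\<lambda>n. CE k t (a n)) (\<lambda>n. CE k t (\<alpha> n))"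
proof -
  have eq: "CE k t \<phi> = (\<Sum>J\<in>{J \<in> tidx m d. J k = t}. (wt J / \<omega> k t) * \<phi> J)" for \<phi>
    by (simp add: CE_def sum_divide_distrib)
  show ?thesis unfolding eq
  proof (rule expands_convex)
    show "(\<Sum>J\<in>{J \<in> tidx m d. J k = t}. wt J / \<omega> k t) = 1"
      using omega_pos[OF assms(1,2)] by (simp add: sum_wt_marginal[OF assms(1,2)] flip: sum_divide_distrib)
  qed (use assms(3) in \<open>auto simp: tidx_finite\<close>)
qed

text \<open>Follows the computation of \<open>T\<close>: completed block, gradient, root, norm,
  quotient. Each stage is an average of products, a power or a division.\<close>

lemma expands_T:
  assumes e: "e \<longlonglongrightarrow> 0" and X: "\<And>n. pos_pt (X n)"
    and w: "\<And>l j. l \<in> K \<Longrightarrow> j < d l \<Longrightarrow> expands e (\<lambda>n. X n l j / xt l j) (\<lambda>n. w n l j)"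
    and l: "l \<in> K" "j < d l"
  shows "expands e (\<lambda>n. T (X n) l j / xt l j) (\<lambda>n. cen (lin (w n)) l j)"
proof -
  have i: "expands e (\<lambda>n. ext (X n) i t / ext xt i t) (\<lambda>n. lin_i (w n) t)" if t: "t < d i" for t
  proof -
    have "expands e (\<lambda>n. CE i t (\<lambda>J. \<Prod>l\<in>K. X n l (J l) / xt l (J l)))
       (\<lambda>n. CE i t (\<lambda>J. \<Sum>k\<in>K. w n k (J k)))"
      by (intro expands_CE expands_prod e w i_less t) (auto simp: tidx_less)
    moreover have "CE i t (\<lambda>J. \<Prod>l\<in>K. X n l (J l) / xt l (J l)) = grad m d f i (X n) t / grad m d f i xt t" for n
      using grad_ratio[OF i_less t, of "X n"] grad_i_pos[OF pos_pt_xt t] by simp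
    ultimately have "expands e (\<lambda>n. grad m d f i (X n) t / grad m d f i xt t) (\<lambda>n. CE i t (\<lambda>J. \<Sum>k\<in>K. w n k (J k)))"
      by simp
    from expands_powr[OF e this, of "q - 1"] show ?thesis
      using grad_i_pos[OF pos_pt_xt t] grad_i_pos[OF X t]
      by (simp add: ext_i[OF X t] ext_i[OF pos_pt_xt t] lin_i_def powr_divide less_imp_le)
  qed
  have S: "expands e (\<lambda>n. S (X n) l j / S xt l j) (\<lambda>n. lin (w n) l j)" if l: "l \<in> K" "j < d l" for l j
  proof -
    define \<alpha> where "\<alpha> n k = (if k = i then lin_i (w n) else w n k)" for n k
    have f: "expands e (\<lambda>n. ext (X n) k t / ext xt k t) (\<lambda>n. \<alpha> n k t)" if "k < m" "t < d k" for k t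
      using i[of t] w[of k t] that by (cases "k = i") (auto simp: \<alpha>_def ext_other)
    have "expands e (\<lambda>n. CE l j (\<lambda>J. \<Prod>k\<in>{..<m} - {l}. ext (X n) k (J k) / ext xt k (J k)))
       (\<lambda>n. CE l j (\<lambda>J. \<Sum>k\<in>{..<m} - {l}. \<alpha> n k (J k)))"
      using l by (intro expands_CE expands_prod e f) (auto simp: tidx_less)
    moreover have "CE l j (\<lambda>J. \<Prod>k\<in>{..<m} - {l}. ext (X n) k (J k) / ext xt k (J k)) =
        grad m d f l (ext (X n)) j / grad m d f l (ext xt) j" for n
      using grad_ratio_ext[OF l, of "ext (X n)"] grad_ext_pos[OF pos_pt_xt l] by simp
    ultimately have *: "expands e (\<lambda>n. grad m d f l (ext (X n)) j / grad m d f l (ext xt) j)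
       (\<lambda>n. CE l j (\<lambda>J. \<Sum>k\<in>{..<m} - {l}. \<alpha> n k (J k)))" by simp
    have eq: "{..<m} - {l} = insert i (K - {l})" using l i_less by auto
    have "(\<Sum>k\<in>{..<m} - {l}. \<alpha> n k (J k)) = (\<Sum>k\<in>K - {l}. w n k (J k)) + lin_i (w n) (J i)" for n J
      unfolding eq by (subst sum.insert) (auto simp: \<alpha>_def)
    then have "1 / b l * CE l j (\<lambda>J. \<Sum>k\<in>{..<m} - {l}. \<alpha> n k (J k)) = lin (w n) l j" for n
      by (simp add: lin_def)
    with expands_powr[OF e *, of "1 / b l"] show ?thesis
      using grad_ext_pos[OF pos_pt_xt l] grad_ext_pos[OF X l]
      by (simp add: S_eq[OF X l] S_eq[OF pos_pt_xt l] powr_divide less_imp_le)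
  qed
  have "expands e (\<lambda>n. (\<Sum>j<d l. \<omega> l j * (S (X n) l j / S xt l j) powr p l) powr (1 / p l))
      (\<lambda>n. 1 / p l * (\<Sum>j<d l. \<omega> l j * (p l * lin (w n) l j)))"
    using l sum_omega[of l] by (intro expands_powr expands_convex e S) auto
  moreover have "1 / p l * (\<Sum>j<d l. \<omega> l j * (p l * lin (w n) l j)) = mean (lin (w n)) l" for n
    unfolding mean_def sum_distrib_left using p_gt1[of l] l by (intro sum.cong) auto
  ultimately have N: "expands e (\<lambda>n. nrm l (X n) / nrm l xt) (\<lambda>n. mean (lin (w n)) l)"
    by (simp add: nrm_ratio[OF X l(1)])
  have "T (X n) l j / xt l j = (S (X n) l j / S xt l j) / (nrm l (X n) / nrm l xt)" for n
    using nrm_pos[OF pos_pt_xt l(1)] unfolding T_xt[OF l, symmetric] T_eq[OF l] by simp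
  then show ?thesis using expands_divide[OF e S[OF l] N] by (simp add: cen_def)
qed

end

section \<open>Strict contraction of the linearised iteration\<close>

context hgpm_setting
begin

definition "Nsq w = (\<Sum>l\<in>K. b l * (\<Sum>j<d l. \<omega> l j * (w l j)\<^sup>2))"

lemma lin_i_lin: "lin_i (\<lambda>l j. u l j + a * v l j) t = lin_i u t + a * lin_i v t"
proof -
  have "CE i t (\<lambda>J. \<Sum>k\<in>K. u k (J k) + a * v k (J k)) =
      CE i t (\<lambda>J. (\<Sum>k\<in>K. u k (J k)) + a * (\<Sum>k\<in>K. v k (J k)))"
    by (simp add: sum.distrib sum_distrib_left)
  then show ?thesis unfolding lin_i_def CE_lin by (simp add: algebra_simps)
qed

lemma lin_lin: "lin (\<lambda>l j. u l j + a * v l j) l j = lin u l j + a * lin v l j"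
proof -
  have "CE l j (\<lambda>J. (\<Sum>k\<in>K - {l}. u k (J k) + a * v k (J k)) + (lin_i u (J i) + a * lin_i v (J i))) =
      CE l j (\<lambda>J. ((\<Sum>k\<in>K - {l}. u k (J k)) + lin_i u (J i)) + a * ((\<Sum>k\<in>K - {l}. v k (J k)) + lin_i v (J i)))"
    by (simp add: sum.distrib sum_distrib_left algebra_simps)
  then show ?thesis unfolding lin_def lin_i_lin CE_lin by (simp add: algebra_simps)
qed

lemma lin_cong:
  assumes "l \<in> K" "\<And>l j. l \<in> K \<Longrightarrow> j < d l \<Longrightarrow> u l j = v l j"
  shows "lin u l j = lin v l j"
proof -
  have "CE i t (\<lambda>J. \<Sum>k\<in>K. u k (J k)) = CE i t (\<lambda>J. \<Sum>k\<in>K. v k (J k))" for t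
    by (intro CE_cong sum.cong assms(2)) (auto simp: tidx_less)
  moreover have "(\<Sum>k\<in>K - {l}. u k (J k)) = (\<Sum>k\<in>K - {l}. v k (J k))" if "J \<in> tidx m d" for J
    by (intro sum.cong assms(2)) (use that in \<open>auto simp: tidx_less\<close>)
  ultimately show ?thesis
    unfolding lin_def lin_i_def by (intro arg_cong2[where f="(*)"] refl CE_cong) auto
qed

text \<open>Infinitesimal form of homogeneity: conditional expectations fix constants, so
  perturbations constant on each block are mapped to such perturbations.\<close>

lemma lin_block_const:
  assumes "l \<in> K" "j < d l"
  shows "lin (\<lambda>l j. c l) l j = (q * (\<Sum>k\<in>K. c k) - c l) / b l"
proof -
  have i: "lin_i (\<lambda>l j. c l) t = (q - 1) * (\<Sum>k\<in>K. c k)" if "t < d i" for t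
    using that i_less by (simp add: lin_i_def CE_const)
  have "CE l j (\<lambda>J. (\<Sum>k\<in>K - {l}. c k) + lin_i (\<lambda>l j. c l) (J i))
     = CE l j (\<lambda>J. (\<Sum>k\<in>K - {l}. c k) + (q - 1) * (\<Sum>k\<in>K. c k))"
    using i i_less by (intro CE_cong) (auto simp: tidx_less)
  also have "\<dots> = (\<Sum>k\<in>K - {l}. c k) + (q - 1) * (\<Sum>k\<in>K. c k)"
    using assms by (simp add: CE_const)
  finally have "lin (\<lambda>l j. c l) l j = ((\<Sum>k\<in>K - {l}. c k) + (q - 1) * (\<Sum>k\<in>K. c k)) / b l"
    by (simp add: lin_def)
  moreover have "(\<Sum>k\<in>K - {l}. c k) = (\<Sum>k\<in>K. c k) - c l"
    using assms by (subst sum.remove[of K l]) auto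
  ultimately show ?thesis by (simp add: algebra_simps)
qed

text \<open>The value is \<open>\<kappa> / b l\<close>, so the exponent condition makes
  \<open>lin\<close> a sub-probability average.\<close>

lemma lin_1_le: "l \<in> K \<Longrightarrow> j < d l \<Longrightarrow> lin (\<lambda>l j. 1) l j \<le> 1"
  using kappa_le_b[of l] b_pos[of l] card_K by (simp add: lin_block_const \<kappa>_def algebra_simps)

lemma lin_i_nonneg:
  assumes "\<And>l j. l \<in> K \<Longrightarrow> j < d l \<Longrightarrow> 0 \<le> h l j" "t < d i"
  shows "0 \<le> lin_i h t"
  unfolding lin_i_def using q_gt1 i_less assms
  by (intro mult_nonneg_nonneg CE_nonneg sum_nonneg) (auto simp: tidx_less)

lemma lin_nonneg:
  assumes "\<And>l j. l \<in> K \<Longrightarrow> j < d l \<Longrightarrow> 0 \<le> h l j" "l \<in> K" "j < d l"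
  shows "0 \<le> lin h l j"
  unfolding lin_def using b_pos[OF assms(2)] assms i_less
  by (intro mult_nonneg_nonneg CE_nonneg add_nonneg_nonneg sum_nonneg lin_i_nonneg)
    (auto simp: tidx_less)

text \<open>Linear counterpart of \<open>S_compare_eq\<close>: a vanishing average of nonnegative
  values vanishes on every positive entry, first for the average in mode \<open>l\<close>, then for
  the one in mode \<open>i\<close>.\<close>

lemma lin_eq_0:
  assumes h: "\<And>l j. l \<in> K \<Longrightarrow> j < d l \<Longrightarrow> 0 \<le> h l j" and l: "l \<in> K"
    and J: "J \<in> tidx m d" "0 < f J" and z: "lin h l (J l) = 0"
    and J': "J' \<in> tidx m d" "0 < f J'" "J' i = J i" and k: "k \<in> K"
  shows "h k (J' k) = 0"
proof -
  have s: "0 \<le> (\<Sum>k\<in>A. h k (J k))" if "A \<subseteq> K" "J \<in> tidx m d" for A J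
    using that by (intro sum_nonneg h) (auto simp: tidx_less)
  have li: "0 \<le> lin_i h (J i)" if "J \<in> tidx m d" for J
    by (rule lin_i_nonneg[OF h]) (use that i_less in \<open>auto simp: tidx_less\<close>)
  have "CE l (J l) (\<lambda>J. (\<Sum>k\<in>K - {l}. h k (J k)) + lin_i h (J i)) = 0"
    using z b_pos[OF l] by (simp add: lin_def)
  from CE_eq_0[OF _ _ J this] have "(\<Sum>k\<in>K - {l}. h k (J k)) + lin_i h (J i) = 0"
    using l s[of "K - {l}"] li by auto
  then have "lin_i h (J i) = 0" using s[of "K - {l}" J] li[OF J(1)] J(1) by auto
  then have "CE i (J' i) (\<lambda>J. \<Sum>k\<in>K. h k (J k)) = 0" using q_gt1 J' by (simp add: lin_i_def)
  from CE_eq_0[OF i_less _ J'(1,2) this] have "(\<Sum>k\<in>K. h k (J' k)) = 0" using s by auto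
  then show ?thesis
    by (subst (asm) sum_nonneg_eq_0_iff) (use h k J' in \<open>auto simp: tidx_less\<close>)
qed

text \<open>Dual to \<open>lin_1_le\<close>: averaging the conditional expectations returns the
  plain means \<open>M k\<close>, each with total coefficient \<open>\<kappa>\<close>, which is at
  most \<open>b k\<close>.\<close>

lemma sum_lin:
  assumes h: "\<And>l j. l \<in> K \<Longrightarrow> j < d l \<Longrightarrow> 0 \<le> h l j"
  shows "(\<Sum>l\<in>K. b l * (\<Sum>j<d l. \<omega> l j * lin h l j)) \<le> (\<Sum>l\<in>K. b l * (\<Sum>j<d l. \<omega> l j * h l j))"
proof -
  define M where "M k = (\<Sum>j<d k. \<omega> k j * h k j)" for k
  have M: "(\<Sum>J\<in>tidx m d. wt J * (\<Sum>k\<in>A. h k (J k))) = (\<Sum>k\<in>A. M k)" if "A \<subseteq> K" for A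
  proof -
    have "(\<Sum>J\<in>tidx m d. wt J * (\<Sum>k\<in>A. h k (J k))) = (\<Sum>k\<in>A. \<Sum>J\<in>tidx m d. wt J * h k (J k))"
      unfolding sum_distrib_left by (rule sum.swap)
    also have "\<dots> = (\<Sum>k\<in>A. M k)"
      unfolding M_def using that by (intro sum.cong refl sum_wt_coordinate) auto
    finally show ?thesis .
  qed
  have i: "(\<Sum>J\<in>tidx m d. wt J * lin_i h (J i)) = (q - 1) * (\<Sum>k\<in>K. M k)"
    unfolding sum_wt_coordinate[OF i_less, of "lin_i h"] unfolding lin_i_def
    using sum_CE[OF i_less] M[of K] by (simp add: mult.left_commute flip: sum_distrib_left)
  have l: "b l * (\<Sum>j<d l. \<omega> l j * lin h l j) = q * (\<Sum>k\<in>K. M k) - M l" if l: "l \<in> K" for l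
  proof -
    have "b l * (\<Sum>j<d l. \<omega> l j * lin h l j) =
        (\<Sum>j<d l. \<omega> l j * CE l j (\<lambda>J. (\<Sum>k\<in>K - {l}. h k (J k)) + lin_i h (J i)))"
      unfolding lin_def sum_distrib_left using b_pos[OF l] by (intro sum.cong) auto
    also have "\<dots> = (\<Sum>k\<in>K - {l}. M k) + (q - 1) * (\<Sum>k\<in>K. M k)"
      using l by (subst sum_CE) (auto simp: distrib_left sum.distrib M i)
    also have "(\<Sum>k\<in>K - {l}. M k) = (\<Sum>k\<in>K. M k) - M l"
      using l by (subst sum.remove[of K l]) auto
    finally show ?thesis by (simp add: algebra_simps)
  qed
  have "(\<Sum>l\<in>K. b l * (\<Sum>j<d l. \<omega> l j * lin h l j)) = \<kappa> * (\<Sum>k\<in>K. M k)"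
  proof -
    have "(\<Sum>l\<in>K. b l * (\<Sum>j<d l. \<omega> l j * lin h l j)) = (\<Sum>l\<in>K. q * (\<Sum>k\<in>K. M k) - M l)"
      using l by (rule sum.cong[OF refl])
    then show ?thesis using card_K by (simp add: sum_subtractf \<kappa>_def algebra_simps)
  qed
  also have "\<dots> \<le> (\<Sum>l\<in>K. b l * M l)"
    unfolding sum_distrib_left
  proof (intro sum_mono mult_right_mono kappa_le_b)
    fix l assume "l \<in> K"
    then show "0 \<le> M l"
      unfolding M_def using h omega_pos[of l] by (intro sum_nonneg mult_nonneg_nonneg) (auto intro: less_imp_le)
  qed
  finally show ?thesis by (simp add: M_def)
qed

text \<open>Jensen's inequality for the sub-probability functional \<open>\<lambda>w. lin w l j\<close>, keeping the defect that
  decides the equality case.\<close>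

lemma lin_defect:
  assumes "l \<in> K" "j < d l"
  shows "lin (\<lambda>k t. (w k t - lin w l j)\<^sup>2) l j \<le> lin (\<lambda>k t. (w k t)\<^sup>2) l j - (lin w l j)\<^sup>2"
proof -
  let ?c = "lin w l j"
  have "lin (\<lambda>k t. (w k t - ?c)\<^sup>2) l j = lin (\<lambda>k t. ((w k t)\<^sup>2 + (- 2 * ?c) * w k t) + ?c\<^sup>2 * 1) l j"
    by (rule lin_cong[OF assms(1)]) (simp add: power2_eq_square algebra_simps)
  also have "\<dots> = lin (\<lambda>k t. (w k t)\<^sup>2) l j - 2 * ?c\<^sup>2 + ?c\<^sup>2 * lin (\<lambda>k t. 1) l j"
    unfolding lin_lin by (simp add: power2_eq_square)
  finally show ?thesis using mult_left_mono[OF lin_1_le[OF assms], of "?c\<^sup>2"] by simp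
qed

lemma Nsq_defect:
  "(\<Sum>l\<in>K. b l * (\<Sum>j<d l. \<omega> l j * lin (\<lambda>k t. (w k t - lin w l j)\<^sup>2) l j)) \<le> Nsq w - Nsq (lin w)"
proof -
  have "(\<Sum>l\<in>K. b l * (\<Sum>j<d l. \<omega> l j * lin (\<lambda>k t. (w k t - lin w l j)\<^sup>2) l j))
      \<le> (\<Sum>l\<in>K. b l * (\<Sum>j<d l. \<omega> l j * (lin (\<lambda>k t. (w k t)\<^sup>2) l j - (lin w l j)\<^sup>2)))"
    using b_pos omega_pos by (intro sum_mono mult_left_mono lin_defect) (auto intro: less_imp_le)
  also have "\<dots> = (\<Sum>l\<in>K. b l * (\<Sum>j<d l. \<omega> l j * lin (\<lambda>k t. (w k t)\<^sup>2) l j)) - Nsq (lin w)"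
    by (simp add: Nsq_def right_diff_distrib sum_subtractf)
  also have "\<dots> \<le> Nsq w - Nsq (lin w)"
    using sum_lin[of "\<lambda>k t. (w k t)\<^sup>2"] by (simp add: Nsq_def)
  finally show ?thesis .
qed

text \<open>If no norm is lost, every Jensen defect vanishes, so \<open>w k (J' k)\<close> equals
  \<open>lin w l (J l)\<close> for positive entries \<open>J\<close>, \<open>J'\<close> with the
  same index in mode \<open>i\<close>. Connectivity makes \<open>w\<close> one constant across all
  blocks, and zero mean makes it 0.\<close>

lemma Nsq_lin_strict:
  assumes mean: "\<And>l. l \<in> K \<Longrightarrow> mean w l = 0" and ge: "Nsq w \<le> Nsq (lin w)" and kt: "k \<in> K" "t < d k"
  shows "w k t = 0"
proof -
  let ?h = "\<lambda>l j. lin (\<lambda>k t. (w k t - lin w l j)\<^sup>2) l j"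
  have h: "0 \<le> ?h l j" if "l \<in> K" "j < d l" for l j
    by (rule lin_nonneg) (use that in auto)
  have nn: "0 \<le> \<omega> l j * ?h l j" if "l \<in> K" "j < d l" for l j
    using h[OF that] omega_pos[of l j] that by simp
  have bnn: "0 \<le> b l * (\<Sum>j<d l. \<omega> l j * ?h l j)" if "l \<in> K" for l
  proof (rule mult_nonneg_nonneg)
    show "0 \<le> (\<Sum>j<d l. \<omega> l j * ?h l j)" using nn[OF that] by (rule sum_nonneg) auto
  qed (use b_pos[OF that] in simp)
  have "(\<Sum>l\<in>K. b l * (\<Sum>j<d l. \<omega> l j * ?h l j)) = 0"
  proof (rule antisym)
    show "(\<Sum>l\<in>K. b l * (\<Sum>j<d l. \<omega> l j * ?h l j)) \<le> 0" using Nsq_defect[of w] ge by linarith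
    show "0 \<le> (\<Sum>l\<in>K. b l * (\<Sum>j<d l. \<omega> l j * ?h l j))"
      using bnn by (rule sum_nonneg)
  qed
  then have s0: "b l * (\<Sum>j<d l. \<omega> l j * ?h l j) = 0" if "l \<in> K" for l
    using that bnn sum_nonneg_eq_0_iff[of K "\<lambda>l. b l * (\<Sum>j<d l. \<omega> l j * ?h l j)"] by blast
  have "(\<Sum>j<d l. \<omega> l j * ?h l j) = 0" if "l \<in> K" for l
    using mult_eq_0_iff[THEN iffD1, OF s0[OF that]] b_pos[OF that] by auto
  then have "\<omega> l j * ?h l j = 0" if "l \<in> K" "j < d l" for l j
    using that nn sum_nonneg_eq_0_iff[of "{..<d l}" "\<lambda>j. \<omega> l j * ?h l j"] by auto
  then have z: "?h l j = 0" if "l \<in> K" "j < d l" for l j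
  proof -
    have "\<omega> l j \<noteq> 0" using that omega_pos[of l j] by auto
    then show ?thesis using \<open>\<And>l j. l \<in> K \<Longrightarrow> j < d l \<Longrightarrow> \<omega> l j * ?h l j = 0\<close>[OF that] by simp
  qed
  have link: "w k (J' k) = lin w l (J l)"
    if "J \<in> tidx m d" "0 < f J" "J' \<in> tidx m d" "0 < f J'" "J' i = J i" "l \<in> K" "k \<in> K" for J J' l k
    using lin_eq_0[of "\<lambda>k t. (w k t - lin w l (J l))\<^sup>2" l J J' k] that z[of l "J l"]
    by (auto simp: tidx_less)
  have const: "w k' t' = w k t" if "k' \<in> K" "t' < d k'" for k' t'
  proof (rule connected_through_mode[where P = "\<lambda>l j. w l j = w k t" and i = i and ?k0.0 = k and ?j0.0 = t])
    fix J J' l k' assume *: "J \<in> tidx m d" "0 < f J" "J' \<in> tidx m d" "0 < f J'" "J' i = J i"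
      "l < m" "l \<noteq> i" "k' < m" "k' \<noteq> i" "w l (J l) = w k t"
    \<comment> \<open>Both \<open>w k' (J' k')\<close> and \<open>w l (J l)\<close> equal
      \<open>lin w l (J l)\<close>; the second use of \<open>link\<close> stays within
      \<open>J\<close>.\<close>
    then show "w k' (J' k') = w k t" using link[of J J' l k'] link[of J J l l] by auto
  qed (use that kt in auto)
  have "mean w k = (\<Sum>j<d k. \<omega> k j) * w k t"
    unfolding mean_def sum_distrib_right
  proof (intro sum.cong refl)
    fix j assume "j \<in> {..<d k}"
    then show "\<omega> k j * w k j = \<omega> k j * w k t" using const[OF kt(1), of j] by simp
  qed
  then show ?thesis using mean[OF kt(1)] sum_omega[of k] kt by simp
qed

lemma Nsq_lin_le: "Nsq (lin w) \<le> Nsq w"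
proof -
  have "0 \<le> (\<Sum>l\<in>K. b l * (\<Sum>j<d l. \<omega> l j * lin (\<lambda>k t. (w k t - lin w l j)\<^sup>2) l j))"
    using b_pos omega_pos
    by (intro sum_nonneg mult_nonneg_nonneg lin_nonneg) (auto intro: less_imp_le)
  then show ?thesis using Nsq_defect[of w] by linarith
qed

lemma mean_cen: "l \<in> K \<Longrightarrow> mean (cen w) l = 0"
  using sum_omega[of l]
  by (simp add: mean_def[of "cen w"] cen_def right_diff_distrib sum_subtractf flip: sum_distrib_right)
    (simp add: mean_def)

text \<open>In each block the variance is at most the second moment.\<close>

lemma Nsq_cen: "Nsq (cen w) \<le> Nsq w"
proof -
  have "(\<Sum>j<d l. \<omega> l j * (cen w l j)\<^sup>2) \<le> (\<Sum>j<d l. \<omega> l j * (w l j)\<^sup>2)" if l: "l \<in> K" for l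
  proof -
    let ?a = "mean w l"
    have "(\<Sum>j<d l. \<omega> l j * (cen w l j)\<^sup>2) =
       (\<Sum>j<d l. \<omega> l j * (w l j)\<^sup>2 - 2 * ?a * (\<omega> l j * w l j) + ?a\<^sup>2 * \<omega> l j)"
      by (intro sum.cong) (auto simp: cen_def power2_eq_square algebra_simps)
    also have "\<dots> = (\<Sum>j<d l. \<omega> l j * (w l j)\<^sup>2) - 2 * ?a * ?a + ?a\<^sup>2"
      using sum_omega[of l] l
      by (simp add: sum.distrib sum_subtractf flip: sum_distrib_left mean_def)
    finally show ?thesis by (simp add: power2_eq_square)
  qed
  then show ?thesis unfolding Nsq_def
    using b_pos by (intro sum_mono[where K = K] mult_left_mono) (auto intro: less_imp_le)
qed

lemma Nsq_cong: "(\<And>l j. l \<in> K \<Longrightarrow> j < d l \<Longrightarrow> u l j = v l j) \<Longrightarrow> Nsq u = Nsq v"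
  unfolding Nsq_def by (intro sum.cong refl arg_cong2[where f="(*)"]) auto

lemma Nsq_zero: "(\<And>l j. l \<in> K \<Longrightarrow> j < d l \<Longrightarrow> u l j = 0) \<Longrightarrow> Nsq u = 0"
  unfolding Nsq_def by (intro sum.neutral ballI) auto

text \<open>Centering changes \<open>w\<close> by block constants; \<open>lin\<close> maps these to
  the block constants \<open>g l\<close>, which the outer centering removes.\<close>

lemma cen_lin_cen:
  assumes "l \<in> K" "j < d l"
  shows "cen (lin (cen w)) l j = cen (lin w) l j"
proof -
  define g where "g l = (q * (\<Sum>k\<in>K. mean w k) - mean w l) / b l" for l
  have *: "lin (cen w) l j = lin w l j - g l" if "l \<in> K" "j < d l" for l j
  proof -
    have "cen w = (\<lambda>l j. w l j + (- 1) * mean w l)" by (simp add: cen_def fun_eq_iff)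
    then have "lin (cen w) l j = lin w l j + (- 1) * lin (\<lambda>l j. mean w l) l j"
      by (simp only: lin_lin)
    then show ?thesis using that by (simp add: lin_block_const g_def)
  qed
  have "mean (lin (cen w)) l = (\<Sum>j<d l. \<omega> l j * lin w l j - \<omega> l j * g l)"
    unfolding mean_def using assms * by (intro sum.cong) (auto simp: right_diff_distrib)
  also have "\<dots> = mean (lin w) l - g l"
    using sum_omega[of l] assms by (simp add: mean_def sum_subtractf flip: sum_distrib_right)
  finally show ?thesis unfolding cen_def[of "lin _"] using *[OF assms] by simp
qed

lemma Nsq_step_le: "Nsq (cen (lin w)) \<le> Nsq (cen w)"
proof -
  have "Nsq (cen (lin w)) = Nsq (cen (lin (cen w)))" by (intro Nsq_cong) (simp add: cen_lin_cen)
  also have "\<dots> \<le> Nsq (lin (cen w))" by (rule Nsq_cen)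
  also have "\<dots> \<le> Nsq (cen w)" by (rule Nsq_lin_le)
  finally show ?thesis .
qed

text \<open>Strictness is available for zero means only, so it is applied to \<open>cen w\<close>.
  The result \<open>Nsq (cen w) = 0\<close> closes the chain
  \<open>Nsq w \<le> Nsq (cen (lin w)) \<le> Nsq (cen w)\<close>.\<close>

lemma Nsq_step_strict:
  assumes "Nsq w \<le> Nsq (cen (lin w))"
  shows "Nsq w \<le> 0"
proof -
  have "Nsq (cen (lin w)) = Nsq (cen (lin (cen w)))" by (intro Nsq_cong) (simp add: cen_lin_cen)
  also have "\<dots> \<le> Nsq (lin (cen w))" by (rule Nsq_cen)
  finally have 1: "Nsq (cen w) \<le> Nsq (lin (cen w))" using assms Nsq_cen[of w] by linarith
  have "Nsq (cen w) = 0"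
    by (rule Nsq_zero) (use Nsq_lin_strict[OF mean_cen 1] in auto)
  then show ?thesis using assms Nsq_step_le[of w] by linarith
qed

section \<open>The weighted norm and its contraction constant\<close>

definition "N w = L2_set (\<lambda>(l, j). sqrt (b l * \<omega> l j) * w l j) U"

lemma N_sqrt: "N w = sqrt (Nsq w)"
proof -
  have "(\<Sum>(l, j)\<in>U. (sqrt (b l * \<omega> l j) * w l j)\<^sup>2) = (\<Sum>l\<in>K. \<Sum>j<d l. (sqrt (b l * \<omega> l j) * w l j)\<^sup>2)"
    unfolding U_def by (subst sum.Sigma) auto
  also have "\<dots> = Nsq w"
    unfolding Nsq_def sum_distrib_left using b_pos omega_pos
    by (intro sum.cong refl) (auto simp: power_mult_distrib less_imp_le)
  finally show ?thesis by (simp add: N_def L2_set_def case_prod_beta)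
qed

lemma N_nonneg: "0 \<le> N w"
  by (simp add: N_def)

lemma weight_pos: "l \<in> K \<Longrightarrow> j < d l \<Longrightarrow> 0 < sqrt (b l * \<omega> l j)"
  using b_pos omega_pos by simp

lemma coordinate_le_N:
  assumes "l \<in> K" "j < d l"
  shows "\<bar>w l j\<bar> \<le> 1 / sqrt (b l * \<omega> l j) * N w"
proof -
  have "\<bar>sqrt (b l * \<omega> l j) * w l j\<bar> \<le> N w"
    unfolding N_def L2_set_def using assms finite_U
      member_le_sum[of "(l, j)" U "\<lambda>a. (case a of (l, j) \<Rightarrow> sqrt (b l * \<omega> l j) * w l j)\<^sup>2"]
    by (intro real_le_rsqrt) (auto simp: U_iff)
  then show ?thesis using weight_pos[OF assms] by (simp add: abs_mult field_simps)
qed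

lemma N_scale: "N (\<lambda>l j. c * w l j) = \<bar>c\<bar> * N w"
proof -
  have "Nsq (\<lambda>l j. c * w l j) = c\<^sup>2 * Nsq w"
    by (simp add: Nsq_def sum_distrib_left power_mult_distrib mult_ac)
  then show ?thesis by (simp add: N_sqrt real_sqrt_mult)
qed

lemma N_add: "N (\<lambda>l j. u l j + v l j) \<le> N u + N v"
proof -
  have "N (\<lambda>l j. u l j + v l j) = L2_set (\<lambda>a. (case a of (l, j) \<Rightarrow> sqrt (b l * \<omega> l j) * u l j) +
      (case a of (l, j) \<Rightarrow> sqrt (b l * \<omega> l j) * v l j)) U"
    unfolding N_def by (intro arg_cong2[where f=L2_set]) (auto simp: fun_eq_iff algebra_simps)
  also have "\<dots> \<le> N u + N v" unfolding N_def by (rule L2_set_triangle_ineq)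
  finally show ?thesis .
qed

lemma tendsto_N: "conv_to X y \<Longrightarrow> (\<lambda>n. N (X n)) \<longlonglongrightarrow> N y"
  unfolding N_sqrt Nsq_def by (intro tendsto_intros) (auto simp: conv_to_def)

lemma conv_to_lin: "conv_to X y \<Longrightarrow> conv_to (\<lambda>n. cen (lin (X n))) (cen (lin y))"
proof -
  assume X: "conv_to X y"
  have i: "(\<lambda>n. lin_i (X n) t) \<longlonglongrightarrow> lin_i y t" for t
    unfolding lin_i_def CE_def divide_inverse using X
    by (intro tendsto_mult tendsto_sum tendsto_const)
      (auto simp: conv_to_def tidx_less)
  have l: "(\<lambda>n. lin (X n) l j) \<longlonglongrightarrow> lin y l j" for l j
    unfolding lin_def CE_def divide_inverse using X i
    by (intro tendsto_mult tendsto_add tendsto_sum tendsto_const)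
      (auto simp: conv_to_def tidx_less)
  show ?thesis unfolding conv_to_def cen_def mean_def
    by (intro ballI allI impI tendsto_diff tendsto_sum tendsto_mult tendsto_const l)
qed

text \<open>Compactness of the unit sphere: unit vectors whose contraction factors tend to 1 would
  have a limit point contradicting \<open>Nsq_step_strict\<close>.\<close>

lemma linearised_contraction: "\<exists>\<nu>. 0 < \<nu> \<and> \<nu> < 1 \<and> (\<forall>w. N (cen (lin w)) \<le> \<nu> * N w)"
proof (rule ccontr)
  assume neg: "\<not> ?thesis"
  \<comment> \<open>Starting at \<open>Suc (Suc n)\<close> keeps the first value, 1/2,
    positive.\<close>
  define \<nu> where "\<nu> n = 1 - inverse (real (Suc (Suc n)))" for n
  have \<nu>: "0 < \<nu> n" "\<nu> n < 1" for n by (auto simp: \<nu>_def field_simps)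
  have le: "N (cen (lin w)) \<le> N w" for w
    unfolding N_sqrt using Nsq_step_le[of w] Nsq_cen[of w] by simp
  have "\<exists>w. N w = 1 \<and> \<nu> n \<le> N (cen (lin w))" for n
  proof -
    obtain w where w: "\<nu> n * N w < N (cen (lin w))" using neg \<nu> by (meson not_le)
    have "N w \<noteq> 0" using w le[of w] by auto
    then have N: "0 < N w" using N_nonneg[of w] by simp
    \<comment> \<open>The form \<open>0 + 1 / N w * w l j\<close> matches
      \<open>lin_lin\<close>.\<close>
    define u where "u = (\<lambda>l j. 0 + 1 / N w * w l j)"
    have "N u = 1" using N_scale[of "1 / N w" w] N by (simp add: u_def)
    moreover have z: "lin (\<lambda>l j. 0) l j = 0" for l j by (simp add: lin_def lin_i_def CE_def)
    have "cen (lin u) = (\<lambda>l j. 1 / N w * cen (lin w) l j)"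
      unfolding u_def lin_lin z cen_def mean_def
      by (simp add: fun_eq_iff right_diff_distrib sum_distrib_left sum_divide_distrib diff_divide_distrib)
    then have "N (cen (lin u)) = 1 / N w * N (cen (lin w))" using N_scale[of "1 / N w"] N by simp
    then have "\<nu> n \<le> N (cen (lin u))" using w N by (simp add: field_simps) (metis less_imp_le mult.commute mult_less_cancel_left_pos)
    ultimately show ?thesis by blast
  qed
  then obtain W where W: "\<And>n. N (W n) = 1" "\<And>n. \<nu> n \<le> N (cen (lin (W n)))" by metis
  have "\<bar>case_prod (W n) a\<bar> \<le> (case a of (l, j) \<Rightarrow> 1 / sqrt (b l * \<omega> l j))" if "a \<in> U" for n a
    using coordinate_le_N[of _ _ "W n"] W(1)[of n] that by (auto simp: U_def)
  from finite_coordinates_subseq[where X = "\<lambda>n. case_prod (W n)", OF finite_U this] obtain r L where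
    r: "strict_mono (r :: nat \<Rightarrow> nat)" and L: "\<forall>a\<in>U. (\<lambda>n. case_prod (W (r n)) a) \<longlonglongrightarrow> L a" by blast
  define y where "y l j = L (l, j)" for l j
  have conv: "conv_to (\<lambda>k. W (r k)) y"
    unfolding conv_to_def y_def using L by (auto simp: U_def)
  have N1: "N y = 1" using tendsto_N[OF conv] W(1) by (simp add: LIMSEQ_const_iff)
  have "\<nu> \<longlonglongrightarrow> 1 - 0"
    unfolding \<nu>_def by (intro tendsto_diff tendsto_const LIMSEQ_Suc[OF LIMSEQ_inverse_real_of_nat])
  then have "(\<lambda>k. \<nu> (r k)) \<longlonglongrightarrow> 1" using LIMSEQ_subseq_LIMSEQ[OF _ r] by (fastforce simp: o_def)
  from LIMSEQ_le[OF this tendsto_N[OF conv_to_lin[OF conv]]]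
  have "1 \<le> N (cen (lin y))" using W(2) by auto
  then have "Nsq y \<le> Nsq (cen (lin y))" using N1 by (simp add: N_sqrt)
  from Nsq_step_strict[OF this] show False using N1 by (simp add: N_sqrt)
qed

section \<open>Linear convergence\<close>

definition "G y = N (\<lambda>l j. y l j / xt l j)" for y :: "nat \<Rightarrow> nat \<Rightarrow> real"

lemma N_cong: "(\<And>l j. l \<in> K \<Longrightarrow> j < d l \<Longrightarrow> u l j = v l j) \<Longrightarrow> N u = N v"
  unfolding N_sqrt by (rule arg_cong[where f=sqrt], rule Nsq_cong)

lemma norm_G: "norm_on_minus m d i G"
  unfolding norm_on_minus_def Let_def
proof (intro conjI ballI allI)
  fix y z :: "nat \<Rightarrow> nat \<Rightarrow> real" and c :: real
  assume y: "y \<in> {y. restr m d i y = y}"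
  show "0 \<le> G y" by (simp add: G_def N_nonneg)
  show "G (\<lambda>l j. c * y l j) = \<bar>c\<bar> * G y"
    unfolding G_def using N_scale[of c "\<lambda>l j. y l j / xt l j"] by simp
  show "G (\<lambda>l j. y l j + z l j) \<le> G y + G z"
    unfolding G_def using N_add[of "\<lambda>l j. y l j / xt l j" "\<lambda>l j. z l j / xt l j"]
    by (simp add: add_divide_distrib)
  show "G y = 0 \<longleftrightarrow> y = (\<lambda>l j. 0)"
  proof
    assume "G y = 0"
    have "y l j = 0" if "l \<in> K" "j < d l" for l j
      using coordinate_le_N[OF that, of "\<lambda>l j. y l j / xt l j"] \<open>G y = 0\<close> xt_pos[of l j] that
      by (auto simp: G_def)
    then have "restr m d i y = (\<lambda>l j. 0)" by (auto simp: restr_def fun_eq_iff)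
    then show "y = (\<lambda>l j. 0)" using y by simp
  next
    assume "y = (\<lambda>l j. 0)"
    then show "G y = 0" using N_scale[of 0 "\<lambda>l j. 0"] by (simp add: G_def)
  qed
qed

lemma G_restr: "G (restr m d i (\<lambda>l j. x l j - xt l j)) = N (\<lambda>l j. x l j / xt l j - 1)"
  unfolding G_def
proof (rule N_cong)
  fix l j assume "l \<in> K" "j < d l"
  then show "restr m d i (\<lambda>l j. x l j - xt l j) l j / xt l j = x l j / xt l j - 1"
    using xt_pos[of l j] by (simp add: restr_def diff_divide_distrib)
qed

lemma linear_convergence:
  assumes x0: "pos_pt x0" "normalized x0"
  shows "\<exists>\<nu> k0. 0 < \<nu> \<and> \<nu> < 1 \<and> 1 \<le> k0 \<and>
    (\<forall>k\<ge>k0. N (\<lambda>l j. xs x0 (k + 1) l j / xt l j - 1) \<le> \<nu> * N (\<lambda>l j. xs x0 k l j / xt l j - 1))"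
proof -
  define w where "w n = (\<lambda>l j. xs x0 n l j / xt l j - 1)" for n
  \<comment> \<open>The error is its own gauge: all expansions are to first order in
    \<open>e\<close>.\<close>
  define e where "e n = N (w n)" for n
  have xt: "xt l j \<noteq> 0" if "l \<in> K" "j < d l" for l j using xt_pos[of l j] that by auto
  have "conv_to w (\<lambda>l j. 0)"
    unfolding conv_to_def w_def
  proof (intro ballI allI impI)
    fix l j assume l: "l \<in> K" "j < d l"
    have "(\<lambda>n. xs x0 n l j / xt l j - 1) \<longlonglongrightarrow> xt l j / xt l j - 1"
      using xs_conv[OF x0] xt[OF l] l by (intro tendsto_intros) (auto simp: conv_to_def)
    then show "(\<lambda>n. xs x0 n l j / xt l j - 1) \<longlonglongrightarrow> 0" using xt[OF l] by simp
  qed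
  from tendsto_N[OF this] have e: "e \<longlonglongrightarrow> 0"
    using N_scale[of 0 "\<lambda>l j. 0"] by (simp add: e_def[abs_def])
  \<comment> \<open>The expansion is exact with zero remainder, so only the \<open>O(e)\<close>
    bound is at stake.\<close>
  have ex: "expands e (\<lambda>n. xs x0 n l j / xt l j) (\<lambda>n. w n l j)" if l: "l \<in> K" "j < d l" for l j
  proof -
    have "(\<lambda>n. w n l j) \<in> O(e)"
      using coordinate_le_N[OF l] N_nonneg
      by (intro bigoI[of _ "1 / sqrt (b l * \<omega> l j)"]) (auto simp: e_def)
    then show ?thesis by (simp add: expands_def w_def)
  qed
  define R where "R n = (\<lambda>l j. w (Suc n) l j - cen (lin (w n)) l j)" for n
  have R: "(\<lambda>n. R n l j) \<in> o(e)" if l: "l \<in> K" "j < d l" for l j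
    using expands_T[OF e xs_pos[OF x0] ex l] by (simp add: expands_def R_def w_def xs_Suc[OF x0])
  have NR: "(\<lambda>n. \<Sum>a\<in>U. case a of (l, j) \<Rightarrow> sqrt (b l * \<omega> l j) * \<bar>R n l j\<bar>) \<in> o(e)"
  proof (rule big_sum_in_smallo)
    fix a assume "a \<in> U"
    then obtain l j where "a = (l, j)" "l \<in> K" "j < d l" by (auto simp: U_def)
    then show "(\<lambda>n. case a of (l, j) \<Rightarrow> sqrt (b l * \<omega> l j) * \<bar>R n l j\<bar>) \<in> o(e)"
      using R[of l j] by simp
  qed
  obtain \<nu> where \<nu>: "0 < \<nu>" "\<nu> < 1" "\<And>w. N (cen (lin w)) \<le> \<nu> * N w"
    using linearised_contraction by blast
  \<comment> \<open>Half of the gap \<open>1 - \<nu>\<close> is granted to the remainder, which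
    leaves the rate \<open>(1 + \<nu>) / 2\<close>.\<close>
  have "0 < (1 - \<nu>) / 2" using \<nu> by simp
  from landau_o.smallD[OF NR this] obtain k0 where
    k0: "\<And>n. n \<ge> k0 \<Longrightarrow> norm (\<Sum>a\<in>U. case a of (l, j) \<Rightarrow> sqrt (b l * \<omega> l j) * \<bar>R n l j\<bar>) \<le> (1 - \<nu>) / 2 * norm (e n)"
    unfolding eventually_sequentially by blast
  have "e (Suc n) \<le> (1 + \<nu>) / 2 * e n" if "n \<ge> k0" for n
  proof -
    have "N (R n) \<le> (\<Sum>a\<in>U. \<bar>case a of (l, j) \<Rightarrow> sqrt (b l * \<omega> l j) * R n l j\<bar>)"
      unfolding N_def by (rule L2_set_le_sum_abs)
    also have "\<dots> = (\<Sum>a\<in>U. case a of (l, j) \<Rightarrow> sqrt (b l * \<omega> l j) * \<bar>R n l j\<bar>)"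
    proof (intro sum.cong refl)
      fix a assume "a \<in> U"
      then obtain l j where "a = (l, j)" "l \<in> K" "j < d l" by (auto simp: U_def)
      then show "\<bar>case a of (l, j) \<Rightarrow> sqrt (b l * \<omega> l j) * R n l j\<bar> =
          (case a of (l, j) \<Rightarrow> sqrt (b l * \<omega> l j) * \<bar>R n l j\<bar>)"
        using weight_pos[of l j] by (simp add: abs_mult)
    qed
    also have "\<dots> \<le> (1 - \<nu>) / 2 * e n"
      using k0[OF that] N_nonneg[of "w n"] by (simp add: e_def)
    finally have "N (R n) \<le> (1 - \<nu>) / 2 * e n" .
    moreover have "w (Suc n) = (\<lambda>l j. cen (lin (w n)) l j + R n l j)" by (simp add: R_def fun_eq_iff)
    then have "e (Suc n) \<le> N (cen (lin (w n))) + N (R n)" unfolding e_def using N_add by simp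
    moreover have "N (cen (lin (w n))) \<le> \<nu> * e n" using \<nu>(3) by (simp add: e_def)
    ultimately show ?thesis by (simp add: field_simps)
  qed
  then show ?thesis using \<nu>(1,2)
    by (intro exI[of _ "(1 + \<nu>) / 2"] exI[of _ "max 1 k0"]) (auto simp: e_def w_def)
qed

end

section \<open>The bounds and the eigenvalue equation\<close>

context hgpm_setting
begin

text \<open>The sign \<open>s\<close> serves both bounds: 1 for the upper and -1 for the lower
  one.\<close>

lemma prod_mx_powr:
  assumes "pos_pt x" "pos_pt y"
  shows "(\<Prod>l\<in>K. mx l x y powr (s * (b l / (q * real (m - 1))))) = exp (s * D x y / (q * real (m - 1)))"
proof -
  have "(\<Prod>l\<in>K. mx l x y powr (s * (b l / (q * real (m - 1))))) =
      (\<Prod>l\<in>K. exp (s * (b l * ln (mx l x y)) / (q * real (m - 1))))"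
  proof (intro prod.cong refl)
    fix l assume "l \<in> K"
    from mx_pos[OF assms this]
    show "mx l x y powr (s * (b l / (q * real (m - 1)))) = exp (s * (b l * ln (mx l x y)) / (q * real (m - 1)))"
      by (simp add: powr_def mult_ac)
  qed
  also have "\<dots> = exp (s * D x y / (q * real (m - 1)))"
    by (simp add: D_def sum_distrib_left sum_divide_distrib exp_sum)
  finally show ?thesis .
qed

lemma exponent_pos: "l \<in> K \<Longrightarrow> 0 < b l / (q * real (m - 1))"
  using b_pos[of l] q_gt1 m2 by simp

text \<open>The exponent is positive, so the power commutes with the maximum. The shift to
  \<open>Suc n\<close> reflects that the bound of index k is computed from iterate k - 1.\<close>

lemma lam_plus_eq:
  assumes x0: "pos_pt x0" "normalized x0"
  shows "hgpm_lam_plus m d f p i x0 (Suc n) = exp (D (S (xs x0 n)) (xs x0 n) / (q * real (m - 1)))"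
proof -
  let ?x = "xs x0 n"
  have x: "pos_pt ?x" "pos_pt (S ?x)" using xs_pos[OF x0] pos_pt_S by auto
  have "Max ((\<lambda>j. (S ?x l j / ?x l j) powr (b l / (q * real (m - 1)))) ` {..<d l})
      = mx l (S ?x) ?x powr (1 * (b l / (q * real (m - 1))))" if l: "l \<in> K" for l
  proof (rule Max_eqI)
    obtain j where "j < d l" "S ?x l j / ?x l j = mx l (S ?x) ?x" using mx_attained[OF l, of "S ?x" ?x] by blast
    then show "mx l (S ?x) ?x powr (1 * (b l / (q * real (m - 1))))
        \<in> (\<lambda>j. (S ?x l j / ?x l j) powr (b l / (q * real (m - 1)))) ` {..<d l}" by force
    fix y assume "y \<in> (\<lambda>j. (S ?x l j / ?x l j) powr (b l / (q * real (m - 1)))) ` {..<d l}"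
    then obtain j where j: "j < d l" "y = (S ?x l j / ?x l j) powr (b l / (q * real (m - 1)))" by auto
    have "0 < S ?x l j / ?x l j" using x j l by (auto simp: pos_pt_def)
    then show "y \<le> mx l (S ?x) ?x powr (1 * (b l / (q * real (m - 1))))"
      unfolding j(2) using exponent_pos[OF l] mx_ge[OF j(1), of "S ?x" ?x] by (simp add: powr_mono2)
  qed simp
  then have "hgpm_lam_plus m d f p i x0 (Suc n) = (\<Prod>l\<in>K. mx l (S ?x) ?x powr (1 * (b l / (q * real (m - 1)))))"
    unfolding hgpm_lam_plus_def Let_def hgpm_x_def
    by (intro prod.cong) (auto simp: q_def b_def xs_def[OF x0])
  then show ?thesis unfolding prod_mx_powr[OF x(2,1)] by simp
qed

text \<open>A minimum of ratios is the reciprocal of the maximum of the inverse ratios, hence the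
  swapped arguments of \<open>D\<close> and the minus sign.\<close>

lemma lam_minus_eq:
  assumes x0: "pos_pt x0" "normalized x0"
  shows "hgpm_lam_minus m d f p i x0 (Suc n) = exp (- D (xs x0 n) (S (xs x0 n)) / (q * real (m - 1)))"
proof -
  let ?x = "xs x0 n"
  have x: "pos_pt ?x" "pos_pt (S ?x)" using xs_pos[OF x0] pos_pt_S by auto
  have eq: "(S ?x l j / ?x l j) powr r = (?x l j / S ?x l j) powr (- r)" if "l \<in> K" "j < d l" for l j r
  proof -
    have "0 < S ?x l j" "0 < ?x l j" using x that by (auto simp: pos_pt_def)
    then show ?thesis by (simp add: powr_minus powr_divide field_simps)
  qed
  have "Min ((\<lambda>j. (S ?x l j / ?x l j) powr (b l / (q * real (m - 1)))) ` {..<d l})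
      = mx l ?x (S ?x) powr (- 1 * (b l / (q * real (m - 1))))" if l: "l \<in> K" for l
  proof (rule Min_eqI)
    obtain j where j: "j < d l" "?x l j / S ?x l j = mx l ?x (S ?x)" using mx_attained[OF l, of ?x "S ?x"] by blast
    show "mx l ?x (S ?x) powr (- 1 * (b l / (q * real (m - 1))))
        \<in> (\<lambda>j. (S ?x l j / ?x l j) powr (b l / (q * real (m - 1)))) ` {..<d l}"
      using eq[OF l j(1), of "b l / (q * real (m - 1))"] j by (intro image_eqI[of _ _ j]) auto
    fix y assume "y \<in> (\<lambda>j. (S ?x l j / ?x l j) powr (b l / (q * real (m - 1)))) ` {..<d l}"
    then obtain j where j: "j < d l" "y = (?x l j / S ?x l j) powr (- (b l / (q * real (m - 1))))"
      using eq[OF l] by auto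
    have "0 < ?x l j / S ?x l j" using x j l by (auto simp: pos_pt_def)
    then show "mx l ?x (S ?x) powr (- 1 * (b l / (q * real (m - 1)))) \<le> y"
      unfolding j(2) using exponent_pos[OF l] mx_ge[OF j(1), of ?x "S ?x"]
      by (simp add: powr_mono2')
  qed simp
  then have "hgpm_lam_minus m d f p i x0 (Suc n) = (\<Prod>l\<in>K. mx l ?x (S ?x) powr (- 1 * (b l / (q * real (m - 1)))))"
    unfolding hgpm_lam_minus_def Let_def hgpm_x_def
    by (intro prod.cong) (auto simp: q_def b_def xs_def[OF x0])
  then show ?thesis unfolding prod_mx_powr[OF x] by simp
qed

text \<open>Each block contributes \<open>b l * (q / b l) * ln lam\<close>, so dividing by
  \<open>q * real (m - 1)\<close> in the bounds yields exactly \<open>lam\<close> at the fixed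
  point.\<close>

lemma D_xt:
  "D (S xt) xt = q * real (m - 1) * ln lam" "D xt (S xt) = - (q * real (m - 1) * ln lam)"
proof -
  have b: "b l \<noteq> 0" if "l \<in> K" for l using b_pos[OF that] by simp
  have "(\<Sum>l\<in>K. b l * (ln (lam powr (q / b l)) - ln 1)) = (\<Sum>l\<in>K. q * ln lam)"
    using lam_pos b by (intro sum.cong) (auto simp: ln_powr)
  also have "\<dots> = q * real (m - 1) * ln lam" using card_K by simp
  finally have s: "(\<Sum>l\<in>K. b l * (ln (lam powr (q / b l)) - ln 1)) = q * real (m - 1) * ln lam" .
  have "D (S xt) xt = D xt xt + (\<Sum>l\<in>K. b l * (ln (lam powr (q / b l)) - ln 1))"
    by (rule D_scale) (use pos_pt_xt lam_pos in \<open>auto simp: S_xt\<close>)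
  then show "D (S xt) xt = q * real (m - 1) * ln lam" using D_xt_xt s by simp
  have "D xt (S xt) = D xt xt + (\<Sum>l\<in>K. b l * (ln 1 - ln (lam powr (q / b l))))"
    by (rule D_scale) (use pos_pt_xt lam_pos in \<open>auto simp: S_xt\<close>)
  also have "(\<Sum>l\<in>K. b l * (ln 1 - ln (lam powr (q / b l)))) = - (\<Sum>l\<in>K. b l * (ln (lam powr (q / b l)) - ln 1))"
    unfolding sum_negf[symmetric] by (intro sum.cong) auto
  finally show "D xt (S xt) = - (q * real (m - 1) * ln lam)" using D_xt_xt s by simp
qed

lemma
  assumes x0: "pos_pt x0" "normalized x0"
  shows lam_plus_decseq: "decseq (\<lambda>n. hgpm_lam_plus m d f p i x0 (Suc n))"
    and lam_minus_incseq: "incseq (\<lambda>n. hgpm_lam_minus m d f p i x0 (Suc n))"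
    and lam_plus_tendsto: "(\<lambda>n. hgpm_lam_plus m d f p i x0 (Suc n)) \<longlonglongrightarrow> lam"
    and lam_minus_tendsto: "(\<lambda>n. hgpm_lam_minus m d f p i x0 (Suc n)) \<longlonglongrightarrow> lam"
proof -
  have r: "0 < q * real (m - 1)" using q_gt1 m2 by simp
  have r0: "q * real (m - 1) \<noteq> 0" using r by linarith
  note xs = xs_pos[OF x0] xs_normalized[OF x0]
  show "decseq (\<lambda>n. hgpm_lam_plus m d f p i x0 (Suc n))"
  proof (rule decseq_SucI)
    fix n
    show "hgpm_lam_plus m d f p i x0 (Suc (Suc n)) \<le> hgpm_lam_plus m d f p i x0 (Suc n)"
      unfolding lam_plus_eq[OF x0] xs_Suc[OF x0] exp_le_cancel_iff
      using upper_quotient_decreasing[OF xs] by (rule divide_right_mono) (rule less_imp_le[OF r])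
  qed
  show "incseq (\<lambda>n. hgpm_lam_minus m d f p i x0 (Suc n))"
  proof (rule incseq_SucI)
    fix n
    show "hgpm_lam_minus m d f p i x0 (Suc n) \<le> hgpm_lam_minus m d f p i x0 (Suc (Suc n))"
      unfolding lam_minus_eq[OF x0] xs_Suc[OF x0] exp_le_cancel_iff
      using lower_quotient_increasing[OF xs] by (intro divide_right_mono le_imp_neg_le less_imp_le[OF r])
  qed
  note c = xs_conv[OF x0] and S = conv_to_S[OF xs_conv[OF x0] xs_pos[OF x0] pos_pt_xt]
  have "(\<lambda>n. exp (D (S (xs x0 n)) (xs x0 n) / (q * real (m - 1)))) \<longlonglongrightarrow> exp (D (S xt) xt / (q * real (m - 1)))"
    using r tendsto_D[OF S c pos_pt_S[OF pos_pt_xt] pos_pt_xt] by (intro tendsto_intros) auto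
  then show "(\<lambda>n. hgpm_lam_plus m d f p i x0 (Suc n)) \<longlonglongrightarrow> lam"
    unfolding lam_plus_eq[OF x0] D_xt nonzero_mult_div_cancel_left[OF r0] exp_ln[OF lam_pos] .
  have "(\<lambda>n. exp (- D (xs x0 n) (S (xs x0 n)) / (q * real (m - 1)))) \<longlonglongrightarrow> exp (- D xt (S xt) / (q * real (m - 1)))"
    using r tendsto_D[OF c S pos_pt_xt pos_pt_S[OF pos_pt_xt]] by (intro tendsto_intros) auto
  then show "(\<lambda>n. hgpm_lam_minus m d f p i x0 (Suc n)) \<longlonglongrightarrow> lam"
    unfolding lam_minus_eq[OF x0] D_xt minus_minus nonzero_mult_div_cancel_left[OF r0] exp_ln[OF lam_pos] .
qed

end

section \<open>The eigenvalue equation of a positive singular vector\<close>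

lemma mlf_update:
  assumes "k < m"
  shows "mlf m d f (x(k := (x k)(j := t))) = mlf m d f x + (t - x k j) * grad m d f k x j"
proof -
  let ?P = "\<lambda>J. \<Prod>l\<in>{..<m} - {k}. x l (J l)"
  have "f J * (\<Prod>l<m. (x(k := (x k)(j := t))) l (J l)) =
      f J * (\<Prod>l<m. x l (J l)) + (if J k = j then (t - x k j) * (f J * ?P J) else 0)" for J
  proof -
    have "(\<Prod>l<m. (x(k := (x k)(j := t))) l (J l)) = ((x k)(j := t)) (J k) * ?P J"
      using assms by (subst prod.remove[of _ k]) (auto intro!: prod.cong)
    moreover have "(\<Prod>l<m. x l (J l)) = x k (J k) * ?P J"
      using assms by (subst prod.remove[of _ k]) auto
    ultimately show ?thesis by (auto simp: algebra_simps)
  qed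
  then have "mlf m d f (x(k := (x k)(j := t))) =
      mlf m d f x + (\<Sum>J\<in>tidx m d. if J k = j then (t - x k j) * (f J * ?P J) else 0)"
    unfolding mlf_def by (simp add: sum.distrib)
  also have "(\<Sum>J\<in>tidx m d. if J k = j then (t - x k j) * (f J * ?P J) else 0) =
      (t - x k j) * grad m d f k x j"
    unfolding grad_def sum_distrib_left by (rule sum.inter_filter[symmetric]) (rule tidx_finite)
  finally show ?thesis .
qed

text \<open>Near a positive coordinate the absolute values drop out and \<open>Qf\<close> is an
  explicit quotient \<open>h\<close>. Its numerator has slope \<open>g\<close>, and its denominator,
  equal to 1 there, has slope \<open>a powr (p k - 1)\<close>; a vanishing derivative is then the
  claim.\<close>

lemma singular_vector_eigen:
  assumes p: "1 < p k" and x: "x \<in> S_pp m d p" and sing: "singular_vector m d f p x"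
    and pos: "0 < mlf m d f x" and k: "k < m" "j < d k"
  shows "grad m d f k x j = mlf m d f x * x k j powr (p k - 1)"
proof -
  define a where "a = x k j"
  define A where "A = (\<Sum>j'\<in>{..<d k} - {j}. \<bar>x k j'\<bar> powr p k)"
  define g where "g = grad m d f k x j"
  define F where "F = mlf m d f x"
  have a: "0 < a" using x k by (simp add: S_pp_def a_def)
  have A0: "0 \<le> A" unfolding A_def by (rule sum_nonneg) auto
  have nrm: "pnorm (p k) (d k) ((x k)(j := t)) = (A + \<bar>t\<bar> powr p k) powr (1 / p k)" for t
    unfolding pnorm_def A_def using k(2)
    by (subst sum.remove[of _ j]) (auto intro!: arg_cong2[where f="(powr)"] sum.cong)
  have "(A + a powr p k) powr (1 / p k) = 1"
    using nrm[of a] x k a by (simp add: S_pp_def a_def abs_of_pos)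
  then have "((A + a powr p k) powr (1 / p k)) powr p k = 1" by simp
  then have A1: "A + a powr p k = 1" using p A0 by (simp add: powr_powr)
  define h where "h t = (F + (t - a) * g) / (A + t powr p k) powr (1 / p k)" for t
  have Q: "Qf m d f p (x(k := (x k)(j := t))) = h t" if "0 < t" "0 < F + (t - a) * g" for t
  proof -
    have "(\<Prod>l<m. pnorm (p l) (d l) ((x(k := (x k)(j := t))) l)) =
        pnorm (p k) (d k) ((x k)(j := t)) * (\<Prod>l\<in>{..<m} - {k}. pnorm (p l) (d l) (x l))"
      using k by (subst prod.remove[of _ k]) (auto intro!: prod.cong)
    also have "(\<Prod>l\<in>{..<m} - {k}. pnorm (p l) (d l) (x l)) = 1"
      using x by (intro prod.neutral) (auto simp: S_pp_def)
    finally show ?thesis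
      using that unfolding Qf_def mlf_update[OF k(1)] nrm
      by (simp add: h_def F_def g_def a_def del: fun_upd_apply)
  qed
  have "((\<lambda>t. F + (t - a) * g) \<longlongrightarrow> F + (a - a) * g) (nhds a)"
    by (intro tendsto_intros filterlim_ident)
  then have "eventually (\<lambda>t. 0 < F + (t - a) * g) (nhds a)"
    using pos by (intro order_tendstoD(1)[of _ "F + (a - a) * g"]) (auto simp: F_def)
  moreover have "eventually (\<lambda>t. 0 < t) (nhds a)"
    using a by (intro order_tendstoD(1)[OF filterlim_ident])
  ultimately have ev: "eventually (\<lambda>t. Qf m d f p (x(k := (x k)(j := t))) = h t) (nhds a)"
    by eventually_elim (rule Q)
  have "((\<lambda>t. Qf m d f p (x(k := (x k)(j := t)))) has_real_derivative 0) (at a)"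
    using sing k by (simp add: singular_vector_def a_def)
  then have h0: "(h has_real_derivative 0) (at a)"
    using DERIV_cong_ev[OF refl ev refl] by simp
  have "((\<lambda>t. A + t powr p k) has_real_derivative p k * a powr (p k - 1)) (at a)"
    using DERIV_add[OF DERIV_const[of A] has_real_derivative_powr[OF a, of "p k"]] by simp
  from DERIV_fun_powr[OF this, of "1 / p k"]
  have "((\<lambda>t. (A + t powr p k) powr (1 / p k)) has_real_derivative a powr (p k - 1)) (at a)"
    using A1 p by simp
  moreover have "((\<lambda>t. F + (t - a) * g) has_real_derivative g) (at a)"
    by (auto intro!: derivative_eq_intros)
  ultimately have "(h has_real_derivative g - F * a powr (p k - 1)) (at a)"
    unfolding h_def using A1 DERIV_divide[of "\<lambda>t. F + (t - a) * g" g a UNIV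
        "\<lambda>t. (A + t powr p k) powr (1 / p k)" "a powr (p k - 1)"] by simp
  with h0 have "g - F * a powr (p k - 1) = 0" using DERIV_unique by blast
  then show ?thesis by (simp add: g_def F_def a_def)
qed


section \<open>Convergence and linear rate of the power method for the given singular vector\<close>

theorem theorem2:
  fixes m :: nat and d :: "nat \<Rightarrow> nat" and f :: "(nat \<Rightarrow> nat) \<Rightarrow> real"
    and p :: "nat \<Rightarrow> real" and i :: nat
    and x0 xt :: "nat \<Rightarrow> nat \<Rightarrow> real"
  assumes m2: "2 \<le> m"
    and nonneg: "nonneg_tensor m d f"
    and wirr: "weakly_irreducible m d f"
    and p_range: "\<forall>k<m. 1 < p k"
    and p_cond: "\<exists>i0<m. real (m - 1) \<le> (p i0 - 1) * (Min (p ` ({..<m} - {i0})) - real (m - 1))"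
    and i_init: "hgpm_index_ok m p i"
    and x0_init: "x0 \<in> S_pp_minus m d p i"
    and xt_pos: "xt \<in> S_pp m d p"
    and xt_sing: "singular_vector m d f p xt"
    and xt_max: "Qf m d f p xt = tnorm m d f p"
  shows
    "(\<forall>k\<ge>1. hgpm_lam_minus m d f p i x0 k \<le> hgpm_lam_minus m d f p i x0 (k + 1)
            \<and> hgpm_lam_minus m d f p i x0 (k + 1) \<le> tnorm m d f p
            \<and> tnorm m d f p \<le> hgpm_lam_plus m d f p i x0 (k + 1)
            \<and> hgpm_lam_plus m d f p i x0 (k + 1) \<le> hgpm_lam_plus m d f p i x0 k)
     \<and> (hgpm_lam_minus m d f p i x0 \<longlonglongrightarrow> tnorm m d f p)
     \<and> (hgpm_lam_plus m d f p i x0 \<longlonglongrightarrow> tnorm m d f p)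
     \<and> (\<forall>l<m. l \<noteq> i \<longrightarrow> (\<forall>j<d l. (\<lambda>k. hgpm_x m d f p i x0 k l j) \<longlonglongrightarrow> xt l j))
     \<and> (\<exists>\<nu> k0 G. 0 < \<nu> \<and> \<nu> < 1 \<and> 1 \<le> k0 \<and> norm_on_minus m d i G \<and>
          (\<forall>k\<ge>k0. G (restr m d i (\<lambda>l j. hgpm_x m d f p i x0 (k + 1) l j - xt l j))
                   \<le> \<nu> * G (restr m d i (\<lambda>l j. hgpm_x m d f p i x0 k l j - xt l j))))"
proof -
  define lam where "lam = mlf m d f xt"
  have i: "i < m" using i_init by (simp add: hgpm_index_ok_def)
  \<comment> \<open>An empty block would have norm 0 instead of 1.\<close>
  have d_pos: "0 < d k" if "k < m" for k
  proof (rule ccontr)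
    assume "\<not> 0 < d k"
    then have "pnorm (p k) (d k) (xt k) = 0" by (simp add: pnorm_def)
    then show False using xt_pos that by (simp add: S_pp_def)
  qed
  have xp: "0 < xt k j" if "k < m" "j < d k" for k j using xt_pos that by (simp add: S_pp_def)
  have "0 \<le> lam" unfolding lam_def mlf_def using nonneg xp
    by (intro sum_nonneg mult_nonneg_nonneg prod_nonneg)
      (auto simp: nonneg_tensor_def tidx_less intro: less_imp_le)
  then have lam: "0 < lam" using xt_sing by (auto simp: singular_vector_def lam_def)
  \<comment> \<open>For \<open>m = 2\<close> the exponent condition is
    \<open>1 \<le> (p 0 - 1) * (p 1 - 1)\<close>, symmetric in the two modes, so it also holds for
    the chosen \<open>i\<close>. For larger \<open>m\<close> the initialization rule is the claim
    itself.\<close>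
  have large: "real (m - 1) * conj_exp (p i) \<le> p k" if k: "k < m" "k \<noteq> i" for k
  proof (cases "m = 2")
    case False
    then show ?thesis using i_init k by (simp add: hgpm_index_ok_def)
  next
    case True
    obtain i0 where i0: "i0 < 2" "1 \<le> (p i0 - 1) * (Min (p ` ({..<2} - {i0})) - 1)"
      using p_cond True by auto
    have "{..<2} - {0} = {1 :: nat}" "{..<2} - {1} = {0 :: nat}" by auto
    then have "1 \<le> (p i - 1) * (p k - 1)"
      using i0 k i True by (cases "i0 = 0"; cases "i = 0") (auto simp: less_2_cases_iff mult.commute)
    moreover have "1 < p i" using p_range i by simp
    ultimately show ?thesis using True by (simp add: conj_exp_def field_simps)
  qed
  interpret hgpm_setting m d f p i xt lam
  proof
    show "pnorm (p k) (d k) (xt k) = 1" if "k < m" for k using xt_pos that by (simp add: S_pp_def)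
    show "grad m d f k xt j = lam * xt k j powr (p k - 1)" if "k < m" "j < d k" for k j
      using singular_vector_eigen[OF _ xt_pos xt_sing] p_range lam that by (simp add: lam_def)
  qed (use m2 nonneg wirr p_range i d_pos xp lam large in auto)
  have "(\<Prod>k<m. pnorm (p k) (d k) (xt k)) = 1" using xt_norm by (intro prod.neutral) auto
  \<comment> \<open>All block norms of \<open>xt\<close> are 1, so its quotient is
    \<open>lam\<close>, and maximality identifies this with the norm of the tensor.\<close>
  then have tn: "tnorm m d f p = lam" using lam xt_max by (simp add: Qf_def lam_def)
  have x0: "pos_pt x0" "normalized x0"
    using x0_init by (auto simp: S_pp_minus_def pos_pt_def normalized_def)
  have hx: "hgpm_x m d f p i x0 = xs x0" by (simp add: fun_eq_iff hgpm_x_def xs_def[OF x0])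
  note mono = lam_plus_decseq[OF x0] lam_minus_incseq[OF x0]
  note lims = lam_plus_tendsto[OF x0] lam_minus_tendsto[OF x0]
  have "hgpm_lam_minus m d f p i x0 k \<le> hgpm_lam_minus m d f p i x0 (k + 1)
            \<and> hgpm_lam_minus m d f p i x0 (k + 1) \<le> lam
            \<and> lam \<le> hgpm_lam_plus m d f p i x0 (k + 1)
            \<and> hgpm_lam_plus m d f p i x0 (k + 1) \<le> hgpm_lam_plus m d f p i x0 k" if "1 \<le> k" for k
  proof -
    obtain n where n: "k = Suc n" using \<open>1 \<le> k\<close> by (cases k) auto
    show ?thesis
      using decseqD[OF mono(1), of n "Suc n"] incseqD[OF mono(2), of n "Suc n"]
        decseq_ge[OF mono(1) lims(1), of "Suc n"] incseq_le[OF mono(2) lims(2), of "Suc n"] n by simp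
  qed
  \<comment> \<open>The limits in \<open>lims\<close> are those of the sequences shifted by
    one.\<close>
  moreover have "hgpm_lam_minus m d f p i x0 \<longlonglongrightarrow> lam" "hgpm_lam_plus m d f p i x0 \<longlonglongrightarrow> lam"
    using lims by (auto intro: LIMSEQ_imp_Suc)
  moreover have "\<forall>l<m. l \<noteq> i \<longrightarrow> (\<forall>j<d l. (\<lambda>k. hgpm_x m d f p i x0 k l j) \<longlonglongrightarrow> xt l j)"
    using xs_conv[OF x0] by (simp add: conv_to_def hx)
  moreover have "\<exists>\<nu> k0 G. 0 < \<nu> \<and> \<nu> < 1 \<and> 1 \<le> k0 \<and> norm_on_minus m d i G \<and>
          (\<forall>k\<ge>k0. G (restr m d i (\<lambda>l j. hgpm_x m d f p i x0 (k + 1) l j - xt l j))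
                   \<le> \<nu> * G (restr m d i (\<lambda>l j. hgpm_x m d f p i x0 k l j - xt l j)))"
  proof -
    obtain \<nu> k0 where "0 < \<nu>" "\<nu> < 1" "1 \<le> k0"
      "\<forall>k\<ge>k0. N (\<lambda>l j. xs x0 (k + 1) l j / xt l j - 1) \<le> \<nu> * N (\<lambda>l j. xs x0 k l j / xt l j - 1)"
      using linear_convergence[OF x0] by blast
    then show ?thesis unfolding hx
      by (intro exI[of _ \<nu>] exI[of _ k0] exI[of _ G] conjI norm_G) (simp_all only: G_restr)
  qed
  ultimately show ?thesis unfolding tn by blast
qed

end
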